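(* Let $\mathbf{H}$ and $(K,\Sigma)$ be the specific objects defined in the context. Then $(K,\Sigma)$ is a local forgetful strongly finitary good creating pair for $\mathbf{H}$, and the forcing notion $\mathbb{Q}^*_\infty(K,\Sigma)$ collapses $\mathfrak{c}$ to $\aleph_0$.
   Context: Convention: in forcing, the larger condition is the stronger one. "Collapses $\mathfrak{c}$ to $\aleph_0$" means it forces that $2^\omega\cap\mathbf{V}$ is countable ($\mathbf{V}$ the ground model). $u\vartriangleleft v$ means that the sequence $v$ extends $u$. $\log=\log_2$. Creatures. Let $\mathbf{H}$ be a function on $\omega$ with $2\le|\mathbf{H}(m)|<\omega$ for all $m$. A creature for $\mathbf{H}$ is a triple $t=(\mathbf{nor}[t],\mathbf{val}[t],\mathbf{dis}[t])$ where $\mathbf{nor}[t]\in\mathbb{R}^{\ge0}$, $\mathbf{dis}[t]$ is hereditarily countable, and for some integers $m^t_{\rm dn}<m^t_{\rm up}<\omega$, $\emptyset\ne\mathbf{val}[t]\subseteq\{\langle u,v\rangle\in\prod_{i<m^t_{\rm dn}}\mathbf{H}(i)\times\prod_{i<m^t_{\rm up}}\mathbf{H}(i):u\vartriangleleft v\}$; $\mathrm{CR}[\mathbf{H}]$ is the family of all creatures for $\mathbf{H}$. For $K\subseteq\mathrm{CR}[\mathbf{H}]$ and $\Sigma:K\to\mathcal{P}(K)$, $(K,\Sigma)$ is a good creating pair for $\mathbf{H}$ if for each $t\in K$: (a) $\mathrm{dom}(\mathbf{val}[t])=\prod_{i<m^t_{\rm dn}}\mathbf{H}(i)$; (b) $t\in\Sigma(t)$,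 and if $s\in\Sigma(t)$ then $\mathbf{val}[s]\subseteq\mathbf{val}[t]$ (so also $m^s_{\rm dn}=m^t_{\rm dn}$, $m^s_{\rm up}=m^t_{\rm up}$); (c) if $s\in\Sigma(t)$ then $\Sigma(s)\subseteq\Sigma(t)$. It is local if $m^t_{\rm up}=m^t_{\rm dn}+1$ for all $t\in K$; strongly finitary if for each $i$, $|\mathbf{H}(i)|<\omega$ and $\{t\in K:m^t_{\rm dn}=i\}$ is finite; forgetful if for all $t\in K$, $v\in\prod_{i<m^t_{\rm up}}\mathbf{H}(i)$ and $u\in\prod_{i<m^t_{\rm dn}}\mathbf{H}(i)$, $\langle v\restriction m^t_{\rm dn},v\rangle\in\mathbf{val}[t]$ implies $\langle u,u^\frown v\restriction[m^t_{\rm dn},m^t_{\rm up})\rangle\in\mathbf{val}[t]$. When $m^t_{\rm up}=m^t_{\rm dn}+1$, "$\mathrm{pos}(t)=A$" with $A\subseteq\mathbf{H}(m^t_{\rm dn})$ means $\mathbf{val}[t]=\{\langle u,u^\frown\langle a\rangle\rangle:u\in\prod_{i<m^t_{\rm dn}}\mathbf{H}(i),\ a\in A\}$. Forcing. For $t_0,\dots,t_n\in K$ with $m^{t_i}_{\rm up}=m^{t_{i+1}}_{\rm dn}$ ($i<n$) and $w\in\prod_{i<m^{t_0}_{\rm dn}}\mathbf{H}(i)$, let $\mathrm{pos}(w,t_0,\dots,t_n)=\{v\in\prod_{j<m^{t_n}_{\rm up}}\mathbf{H}(j): w\vartriangleleft v\ \&\ (\forall i\le n)(\langle v\restriction m^{t_i}_{\rm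 dn},v\restriction m^{t_i}_{\rm up}\rangle\in\mathbf{val}[t_i])\}$. Conditions of $\mathbb{Q}^*_\infty(K,\Sigma)$ are sequences $p=(w^p,t^p_0,t^p_1,\dots)$ with $t^p_i\in K$, $m^{t^p_i}_{\rm up}=m^{t^p_{i+1}}_{\rm dn}$ for all $i$, $w^p\in\prod_{i<m^{t^p_0}_{\rm dn}}\mathbf{H}(i)$ and $\lim_{n\to\infty}\mathbf{nor}[t^p_n]=\infty$. Order: $p\le q$ iff for some $i<\omega$, $w^q\in\mathrm{pos}(w^p,t^p_0,\dots,t^p_{i-1})$ (meaning $w^q=w^p$ if $i=0$) and $t^q_n\in\Sigma(t^p_{n+i})$ for all $n<\omega$. The function $f_k$. For real $x>0$, $i\ge0$ and an integer $k\ge1$, $f_k(x,i)=\frac{\log(\log(\log(x))-i)}{k}$ if all three logarithms are well defined and attain a value $\ge1$; otherwise $f_k(x,i)=1$. The specific objects. Let $\bar m=\langle m_i:i<\omega\rangle$ be an increasing sequence of integers with $m_0=0$ and $m_{i+1}-m_i>4^{i+3}$. For $j<\omega$ let $\mathbf{H}(j)=i+2=\{0,\dots,i+1\}$, where $i$ is such that $m_i\le j<m_{i+1}$. Let $l_n=|\mathbf{H}(n)|$; let $k_n=\lfloor\sqrt{\max\{k\in\omega\setminus\{0\}:f_k(l_n,0)>1\}}\rfloor$ if $l_n>2^{2^{16}}$, and $k_n=2$ if $l_n\le2^{2^{16}}$. $K$ consists of all creatures $t\in\mathrm{CR}[\mathbf{H}]$ such that $\mathbf{dis}[t]=\langle m^t,A^t,i^t\rangle$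 for some $m^t<\omega$, $\emptyset\ne A^t\subseteq\mathbf{H}(m^t)$, $i^t\in\omega$, $0\le i^t\le\log(\log(l_{m^t}))$; and $\mathbf{nor}[t]=f_{k_{m^t}}(|A^t|,i^t)$, $m^t_{\rm dn}=m^t$, $m^t_{\rm up}=m^t+1$, $\mathrm{pos}(t)=A^t$. For $t\in K$, $\Sigma(t)=\{s\in K:m^s=m^t\ \&\ A^s\subseteq A^t\ \&\ i^s\ge i^t\}$. *)

theory Defs
  imports Complex_Main "HOL-Library.Sublist"
begin

section \<open>Creatures and creating pairs\<close>

text \<open>
  \<open>seqs H n\<close> is the product of \<open>H i\<close> over \<open>i < n\<close>; finite sequences are lists, and
  ``\<open>v\<close> extends \<open>u\<close>'' is \<open>prefix u v\<close>.
\<close>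

definition seqs :: "(nat \<Rightarrow> 'a set) \<Rightarrow> nat \<Rightarrow> 'a list set" where
  "seqs H n = {u. length u = n \<and> (\<forall>i<n. u ! i \<in> H i)}"

text \<open>
  The third component ranges over a type \<open>'d\<close> instead of the class of hereditarily countable
  sets. Below \<open>'d\<close> is \<open>nat \<times> nat set \<times> nat\<close>, all of whose elements are hereditarily countable.
\<close>

datatype ('a, 'd) creature =
  Creature (nor: real) (val: "('a list \<times> 'a list) set") (dis: 'd)

definition transitions :: "(nat \<Rightarrow> 'a set) \<Rightarrow> nat \<Rightarrow> nat \<Rightarrow> ('a list \<times> 'a list) set" where
  "transitions H dn up = {(u, v). u \<in> seqs H dn \<and> v \<in> seqs H up \<and> prefix u v}"

definition CR :: "(nat \<Rightarrow> 'a set) \<Rightarrow> ('a, 'd) creature set" where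
  "CR H = {t. nor t \<ge> 0 \<and>
      (\<exists>dn up. dn < up \<and> val t \<noteq> {} \<and> val t \<subseteq> transitions H dn up)}"

text \<open>As \<open>val t\<close> is nonempty, the two levels are determined by the lengths of the sequences.\<close>

definition m_dn :: "('a, 'd) creature \<Rightarrow> nat" where
  "m_dn t = (THE n. \<forall>(u, v) \<in> val t. length u = n)"

definition m_up :: "('a, 'd) creature \<Rightarrow> nat" where
  "m_up t = (THE n. \<forall>(u, v) \<in> val t. length v = n)"

definition good_creating_pair ::
  "(nat \<Rightarrow> 'a set) \<Rightarrow> ('a, 'd) creature set \<Rightarrow>
   (('a, 'd) creature \<Rightarrow> ('a, 'd) creature set) \<Rightarrow> bool" where
  "good_creating_pair H K \<Sigma> \<longleftrightarrow>
     (\<forall>m. finite (H m) \<and> 2 \<le> card (H m)) \<and>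
     K \<subseteq> CR H \<and> (\<forall>t\<in>K. \<Sigma> t \<subseteq> K) \<and>
     (\<forall>t\<in>K. Domain (val t) = seqs H (m_dn t) \<and>
        t \<in> \<Sigma> t \<and> (\<forall>s\<in>\<Sigma> t. val s \<subseteq> val t) \<and>
        (\<forall>s\<in>\<Sigma> t. \<Sigma> s \<subseteq> \<Sigma> t))"

definition local_creatures :: "('a, 'd) creature set \<Rightarrow> bool" where
  "local_creatures K \<longleftrightarrow> (\<forall>t\<in>K. m_up t = m_dn t + 1)"

definition strongly_finitary :: "(nat \<Rightarrow> 'a set) \<Rightarrow> ('a, 'd) creature set \<Rightarrow> bool" where
  "strongly_finitary H K \<longleftrightarrow> (\<forall>i. finite (H i) \<and> finite {t \<in> K. m_dn t = i})"

definition forgetful :: "(nat \<Rightarrow> 'a set) \<Rightarrow> ('a, 'd) creature set \<Rightarrow> bool" where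
  "forgetful H K \<longleftrightarrow>
     (\<forall>t\<in>K. \<forall>v \<in> seqs H (m_up t). \<forall>u \<in> seqs H (m_dn t).
        (take (m_dn t) v, v) \<in> val t \<longrightarrow> (u, u @ drop (m_dn t) v) \<in> val t)"

text \<open>``\<open>pos(t) = A\<close>'' for a local creature \<open>t\<close>.\<close>

definition has_pos :: "(nat \<Rightarrow> 'a set) \<Rightarrow> ('a, 'd) creature \<Rightarrow> 'a set \<Rightarrow> bool" where
  "has_pos H t A \<longleftrightarrow> val t = {(u, u @ [a]) | u a. u \<in> seqs H (m_dn t) \<and> a \<in> A}"

section \<open>The forcing notion of a creating pair\<close>

text \<open>
  \<open>pos_seq H w t n\<close> is \<open>pos(w, t\<^sub>0, \<dots>, t\<^sub>n\<^sub>-\<^sub>1)\<close>, which is \<open>{w}\<close> for \<open>n = 0\<close>.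
\<close>

definition pos_seq ::
  "(nat \<Rightarrow> 'a set) \<Rightarrow> 'a list \<Rightarrow> (nat \<Rightarrow> ('a, 'd) creature) \<Rightarrow> nat \<Rightarrow> 'a list set" where
  "pos_seq H w t n =
     (if n = 0 then {w}
      else {v \<in> seqs H (m_up (t (n - 1))). prefix w v \<and>
              (\<forall>i<n. (take (m_dn (t i)) v, take (m_up (t i)) v) \<in> val (t i))})"

type_synonym ('a, 'd) cond = "'a list \<times> (nat \<Rightarrow> ('a, 'd) creature)"

definition Q_infty :: "(nat \<Rightarrow> 'a set) \<Rightarrow> ('a, 'd) creature set \<Rightarrow> ('a, 'd) cond set" where
  "Q_infty H K = {(w, t).
      (\<forall>i. t i \<in> K) \<and> (\<forall>i. m_up (t i) = m_dn (t (Suc i))) \<and>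
      w \<in> seqs H (m_dn (t 0)) \<and>
      filterlim (\<lambda>n. nor (t n)) at_top sequentially}"

definition Q_le ::
  "(nat \<Rightarrow> 'a set) \<Rightarrow> (('a, 'd) creature \<Rightarrow> ('a, 'd) creature set) \<Rightarrow>
   ('a, 'd) cond \<Rightarrow> ('a, 'd) cond \<Rightarrow> bool" where
  "Q_le H \<Sigma> p q \<longleftrightarrow>
     (\<exists>i. fst q \<in> pos_seq H (fst p) (snd p) i \<and> (\<forall>n. snd q n \<in> \<Sigma> (snd p (n + i))))"

section \<open>Forcing\<close>

text \<open>
  A forcing notion is a nonempty set \<open>P\<close> with a preorder \<open>le\<close>; larger conditions are stronger.
  The ground model is the HOL universe. A sentence of the forcing language is represented by the
  predicate ``\<open>p\<close> forces it'', and the logical operations are given by the recursive clauses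
  of the forcing relation; implication and existence are the classical abbreviations. Bounded
  quantification over a set \<open>A\<close> serves both for quantifiers over the elements of a ground model
  set \<open>A\<close> and, with a set of names for \<open>A\<close>, for quantifiers over the subsets in the extension.
\<close>

definition forcing_notion :: "'p set \<Rightarrow> ('p \<Rightarrow> 'p \<Rightarrow> bool) \<Rightarrow> bool" where
  "forcing_notion P le \<longleftrightarrow> P \<noteq> {} \<and> (\<forall>p\<in>P. le p p) \<and>
     (\<forall>p\<in>P. \<forall>q\<in>P. \<forall>r\<in>P. le p q \<longrightarrow> le q r \<longrightarrow> le p r)"

type_synonym 'p fsentence = "'p \<Rightarrow> bool"

definition f_not :: "'p set \<Rightarrow> ('p \<Rightarrow> 'p \<Rightarrow> bool) \<Rightarrow> 'p fsentence \<Rightarrow> 'p fsentence" where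
  "f_not P le \<phi> p \<longleftrightarrow> (\<forall>q\<in>P. le p q \<longrightarrow> \<not> \<phi> q)"

definition f_and :: "'p fsentence \<Rightarrow> 'p fsentence \<Rightarrow> 'p fsentence" where
  "f_and \<phi> \<psi> p \<longleftrightarrow> \<phi> p \<and> \<psi> p"

definition f_all :: "'x set \<Rightarrow> ('x \<Rightarrow> 'p fsentence) \<Rightarrow> 'p fsentence" where
  "f_all A \<phi> p \<longleftrightarrow> (\<forall>x\<in>A. \<phi> x p)"

definition f_imp ::
  "'p set \<Rightarrow> ('p \<Rightarrow> 'p \<Rightarrow> bool) \<Rightarrow> 'p fsentence \<Rightarrow> 'p fsentence \<Rightarrow> 'p fsentence" where
  "f_imp P le \<phi> \<psi> = f_not P le (f_and \<phi> (f_not P le \<psi>))"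

definition f_ex ::
  "'p set \<Rightarrow> ('p \<Rightarrow> 'p \<Rightarrow> bool) \<Rightarrow> 'x set \<Rightarrow> ('x \<Rightarrow> 'p fsentence) \<Rightarrow> 'p fsentence" where
  "f_ex P le A \<phi> = f_not P le (f_all A (\<lambda>x. f_not P le (\<phi> x)))"

text \<open>
  A name for a subset of the ground model set \<open>X\<close> is a set \<open>\<tau>\<close> of pairs \<open>(x, s)\<close> with \<open>x\<close> in \<open>X\<close>
  and \<open>s\<close> in \<open>P\<close>, where \<open>x\<close> stands for its own canonical name; every subset of \<open>X\<close> in the
  extension has a name of this form. The two atomic sentences are ``\<open>x\<close> belongs to \<open>\<tau>\<close>'' and
  ``\<open>x = y\<close>'' for canonical names.
\<close>

definition subset_names :: "'p set \<Rightarrow> 'x set \<Rightarrow> ('x \<times> 'p) set set" where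
  "subset_names P X = Pow (X \<times> P)"

definition f_mem ::
  "'p set \<Rightarrow> ('p \<Rightarrow> 'p \<Rightarrow> bool) \<Rightarrow> 'x \<Rightarrow> ('x \<times> 'p) set \<Rightarrow> 'p fsentence" where
  "f_mem P le x \<tau> p \<longleftrightarrow>
     (\<forall>q\<in>P. le p q \<longrightarrow> (\<exists>r\<in>P. le q r \<and> (\<exists>s. (x, s) \<in> \<tau> \<and> le s r)))"

definition f_eq :: "'x \<Rightarrow> 'x \<Rightarrow> 'p fsentence" where
  "f_eq x y p \<longleftrightarrow> x = y"

text \<open>The sentence ``there is an injective function from \<open>X\<close> to \<open>\<omega>\<close>''.\<close>

definition f_countable :: "'p set \<Rightarrow> ('p \<Rightarrow> 'p \<Rightarrow> bool) \<Rightarrow> 'x set \<Rightarrow> 'p fsentence" where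
  "f_countable P le X =
     f_ex P le (subset_names P (X \<times> (UNIV :: nat set))) (\<lambda>\<tau>.
       f_and (f_all X (\<lambda>x. f_ex P le UNIV (\<lambda>n. f_mem P le (x, n) \<tau>)))
      (f_and (f_all X (\<lambda>x. f_all UNIV (\<lambda>n. f_all UNIV (\<lambda>n'.
                f_imp P le (f_and (f_mem P le (x, n) \<tau>) (f_mem P le (x, n') \<tau>)) (f_eq n n')))))
             (f_all X (\<lambda>x. f_all X (\<lambda>x'. f_all UNIV (\<lambda>n.
                f_imp P le (f_and (f_mem P le (x, n) \<tau>) (f_mem P le (x', n) \<tau>)) (f_eq x x')))))))"

definition collapses_continuum :: "'p set \<Rightarrow> ('p \<Rightarrow> 'p \<Rightarrow> bool) \<Rightarrow> bool" where
  "collapses_continuum P le \<longleftrightarrow> (\<forall>p\<in>P. f_countable P le (UNIV :: (nat \<Rightarrow> bool) set) p)"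

section \<open>The specific creating pair\<close>

text \<open>
  The positivity conditions say that the three logarithms are defined (\<open>ln\<close> is a total function
  in HOL).
\<close>

definition f_norm :: "nat \<Rightarrow> real \<Rightarrow> real \<Rightarrow> real" where
  "f_norm k x i =
     (if 0 < x \<and> 0 < log 2 x \<and> 0 < log 2 (log 2 x) - i \<and>
         1 \<le> log 2 x \<and> 1 \<le> log 2 (log 2 x) \<and> 1 \<le> log 2 (log 2 (log 2 x) - i)
      then log 2 (log 2 (log 2 x) - i) / real k else 1)"

definition H_seq :: "(nat \<Rightarrow> nat) \<Rightarrow> nat \<Rightarrow> nat set" where
  "H_seq m j = {0 .. (THE i. m i \<le> j \<and> j < m (Suc i)) + 1}"

definition l_seq :: "(nat \<Rightarrow> nat) \<Rightarrow> nat \<Rightarrow> nat" where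
  "l_seq m n = card (H_seq m n)"

definition k_seq :: "(nat \<Rightarrow> nat) \<Rightarrow> nat \<Rightarrow> nat" where
  "k_seq m n =
     (if l_seq m n > 2 ^ (2 ^ 16)
      then nat \<lfloor>sqrt (real (Max {k. k \<noteq> 0 \<and> f_norm k (real (l_seq m n)) 0 > 1}))\<rfloor>
      else 2)"

type_synonym creature0 = "(nat, nat \<times> nat set \<times> nat) creature"

definition K_pair :: "(nat \<Rightarrow> nat) \<Rightarrow> creature0 set" where
  "K_pair m = {t \<in> CR (H_seq m). \<exists>mt A i. dis t = (mt, A, i) \<and>
      A \<noteq> {} \<and> A \<subseteq> H_seq m mt \<and> real i \<le> log 2 (log 2 (real (l_seq m mt))) \<and>
      nor t = f_norm (k_seq m mt) (real (card A)) (real i) \<and>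
      m_dn t = mt \<and> m_up t = mt + 1 \<and> has_pos (H_seq m) t A}"

definition Sigma_pair :: "(nat \<Rightarrow> nat) \<Rightarrow> creature0 \<Rightarrow> creature0 set" where
  "Sigma_pair m t = {s \<in> K_pair m.
      case (dis s, dis t) of ((ms, As, i_s), (mt, At, i_t)) \<Rightarrow>
        ms = mt \<and> As \<subseteq> At \<and> i_s \<ge> i_t}"

end

theory Submission
  imports Defs "HOL-Library.Countable"
begin

text \<open>
  On block \<open>i\<close>, the interval from \<open>m i\<close> to \<open>m (Suc i)\<close>, the generic sequence \<open>W\<close> takes values
  among \<open>l = i + 2\<close> numbers. A norm of at least \<open>5\<close> forces \<open>card A \<ge> (log 2 l) ^ 4\<close>, because
  \<open>k_seq\<close> is about \<open>sqrt (log log log l)\<close>. Hence, by the counting argument for property B, there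
  is one two-colouring of the \<open>l\<close> values both of whose colour classes meet each of any \<open>l + 2\<close>
  such sets in at least \<open>sqrt (card A)\<close> points, and restricting \<open>A\<close> to one colour costs at most
  \<open>1\<close> in the norm. So, once a condition has large norms, the colours of the first \<open>l + 2\<close> values
  of \<open>W\<close> in every block can be prescribed arbitrarily. Use the first \<open>l + 1\<close> of them to name the
  colouring that is to be used on the next block and the last one to code a bit. From a starting
  block and a colouring of it, \<open>W\<close> thus decodes an infinite sequence of bits. There are countably
  many starts, and by density each ground model real is decoded from one of them.
\<close>

section \<open>Norms\<close>

lemma f_norm_nonneg: "0 \<le> f_norm k x i"
  by (auto simp: f_norm_def intro!: divide_nonneg_nonneg)

text \<open>The default value of \<open>f_norm\<close> is 1, so a larger value comes from the first
  branch, with all logarithms in range. Here \<open>k\<close> is nonzero because division by zero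
  gives 0.\<close>

lemma f_norm_gt_oneD:
  assumes "1 < f_norm k x i"
  shows "0 < k" "0 < x" "1 \<le> log 2 x" "1 \<le> log 2 (log 2 x)"
    "0 < log 2 (log 2 x) - i" "log 2 (log 2 (log 2 x) - i) = real k * f_norm k x i"
  using assms by (cases "k = 0"; auto simp: f_norm_def split: if_splits)+

text \<open>A square root halves \<open>log 2 a\<close>, hence lowers \<open>log 2 (log 2 a)\<close>
  by 1. Norm 5 makes \<open>y \<ge> 32\<close>, so \<open>y - 1 \<ge> y / 2\<close>: the outermost
  logarithm drops by at most 1 and the norm by at most \<open>1 / k\<close>. The same bound keeps
  \<open>f_norm k b i\<close> in its first branch.\<close>

lemma f_norm_sqrt:
  assumes f: "5 \<le> f_norm k a i" and i: "0 \<le> i" and b: "sqrt a \<le> b"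
  shows "f_norm k a i - 1 \<le> f_norm k b i"
proof -
  have f1: "1 < f_norm k a i" using f by simp
  note d = f_norm_gt_oneD[OF f1]
  define y where "y = log 2 (log 2 a) - i"
  have k: "1 \<le> real k" using d(1) by simp
  have y0: "0 < y" using d(5) y_def by simp
  have ly: "log 2 y = real k * f_norm k a i" using d(6) y_def by simp
  have "1 * 5 \<le> real k * f_norm k a i" by (rule mult_mono) (use k f in auto)
  then have ly5: "5 \<le> log 2 y" using ly by simp
  then have y32: "32 \<le> y" using y0 by (simp add: le_log_iff)
  have a32: "32 \<le> log 2 (log 2 a)" using y32 i y_def by simp
  have la0: "0 < log 2 a" using d(3) by simp
  have la: "2 powr 32 \<le> log 2 a" using a32 la0 by (simp add: le_log_iff)
  have b0: "0 < b" using b d(2) by (meson less_le_trans real_sqrt_gt_zero)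
  have "log 2 (sqrt a) \<le> log 2 b" using b d(2) b0 by simp
  moreover have "log 2 (sqrt a) = log 2 a / 2"
    using d(2) by (simp add: powr_half_sqrt[symmetric] log_powr)
  ultimately have lb: "log 2 a / 2 \<le> log 2 b" by simp
  have lb1: "1 \<le> log 2 b" using lb la by simp
  have "log 2 (log 2 a / 2) \<le> log 2 (log 2 b)" using lb la0 lb1 by simp
  moreover have "log 2 (log 2 a / 2) = log 2 (log 2 a) - 1" using la0 by (simp add: log_divide)
  ultimately have llb: "log 2 (log 2 a) - 1 \<le> log 2 (log 2 b)" by simp
  have y': "y / 2 \<le> log 2 (log 2 b) - i" using llb y32 y_def by simp
  then have "log 2 (y / 2) \<le> log 2 (log 2 (log 2 b) - i)" using y32 by simp
  moreover have "log 2 (y / 2) = log 2 y - 1" using y0 by (simp add: log_divide)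
  ultimately have ly': "log 2 y - 1 \<le> log 2 (log 2 (log 2 b) - i)" by simp
  have "f_norm k b i = log 2 (log 2 (log 2 b) - i) / real k"
    unfolding f_norm_def by (rule if_P, intro conjI) (use b0 lb1 llb a32 y' y32 ly' ly5 in linarith)+
  moreover have "(log 2 y - 1) / real k \<le> log 2 (log 2 (log 2 b) - i) / real k"
    using ly' k by (simp add: divide_right_mono)
  moreover have "f_norm k a i - 1 \<le> (log 2 y - 1) / real k"
    using ly k by (simp add: field_simps)
  ultimately show ?thesis by linarith
qed

section \<open>Iterated logarithms and the size of \<open>k_seq\<close>\<close>

lemma le_log2_of_powr_le:
  assumes "2 powr (c::real) \<le> x"
  shows "c \<le> log 2 x"
proof -
  have "0 < x" using assms by (rule less_le_trans[rotated]) simp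
  then show ?thesis using assms by (simp add: le_log_iff)
qed

lemma filterlim_log2: "filterlim (log 2) at_top (at_top :: real filter)"
  unfolding filterlim_at_top
proof
  fix Z :: real
  show "\<forall>\<^sub>F x in at_top. Z \<le> log 2 x"
    by (rule eventually_at_top_linorderI[of "2 powr Z"]) (rule le_log2_of_powr_le)
qed

lemma loglog_large:
  assumes "2 ^ (2 ^ 16) < (l::nat)"
  shows "2 ^ 16 \<le> log 2 (real l)" "16 \<le> log 2 (log 2 (real l))" "4 \<le> log 2 (log 2 (log 2 (real l)))"
proof -
  have "(2::real) powr real ((2::nat) ^ 16) = 2 ^ (2 ^ 16)"
    by (rule powr_realpow) simp
  moreover have "real ((2::nat) ^ 16) = 2 ^ 16" by simp
  ultimately have "(2::real) powr (2 ^ 16) = 2 ^ (2 ^ 16)" by metis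
  also have "\<dots> \<le> real l"
    using of_nat_mono[OF less_imp_le[OF assms], where ?'a = real]
    unfolding of_nat_power of_nat_numeral .
  finally show 1: "2 ^ 16 \<le> log 2 (real l)" by (rule le_log2_of_powr_le)
  have "(2::real) powr 16 = 2 ^ 16" by simp
  then show 2: "16 \<le> log 2 (log 2 (real l))" using 1 by (intro le_log2_of_powr_le[of 16]) linarith
  have "(2::real) powr 4 = 16" by simp
  then show "4 \<le> log 2 (log 2 (log 2 (real l)))" using 2 by (intro le_log2_of_powr_le[of 4]) linarith
qed

lemma f_norm_full:
  assumes l: "2 ^ (2 ^ 16) < (l::nat)"
  shows "f_norm k (real l) 0 = log 2 (log 2 (log 2 (real l))) / real k"
proof -
  have l0: "0 < real l" using order.strict_trans1[OF le0 l] by simp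
  define y z where "y = log 2 (real l)" and "z = log 2 y"
  have "2 ^ 16 \<le> y" "16 \<le> z" "4 \<le> log 2 z"
    using loglog_large[OF l] unfolding y_def z_def by blast+
  moreover have "(1::real) \<le> 2 ^ 16" by simp
  ultimately have "0 < y" "1 \<le> y" "0 < z" "1 \<le> z" "1 \<le> log 2 z" by linarith+
  then show ?thesis
    unfolding f_norm_def using l0 unfolding y_def[symmetric] z_def[symmetric]
    by (simp only: if_True simp_thms diff_0_right)
qed

text \<open>For the full set the norm is \<open>L / k\<close>, so the set in the definition of
  \<open>k_seq\<close> consists of the positive integers below \<open>L\<close>;
  \<open>k_seq\<close> is the integer part of the square root of the largest of them.\<close>

lemma k_seq_bounds:
  assumes l: "2 ^ (2 ^ 16) < l_seq m n"
  defines "L \<equiv> log 2 (log 2 (log 2 (real (l_seq m n))))"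
  shows "0 < k_seq m n" "real (k_seq m n) ^ 2 \<le> L" "L \<le> (real (k_seq m n) + 1) ^ 2"
proof -
  define S where "S = {k. k \<noteq> 0 \<and> f_norm k (real (l_seq m n)) 0 > 1}"
  note ll = loglog_large[OF l]
  have f: "f_norm k (real (l_seq m n)) 0 = L / real k" for k
    unfolding L_def by (rule f_norm_full[OF l])
  have S: "S = {k. k \<noteq> 0 \<and> real k < L}"
    unfolding S_def f by (auto simp: field_simps)
  have "S \<subseteq> {..nat \<lceil>L\<rceil>}" unfolding S by (auto) linarith
  then have fin: "finite S" using finite_subset by blast
  have L4: "4 \<le> L" using ll L_def by simp
  have "1 \<in> S" unfolding S using L4 by simp
  have MS: "Max S \<in> S" using fin \<open>1 \<in> S\<close> by (intro Max_in) auto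
  have M1: "1 \<le> Max S" using fin \<open>1 \<in> S\<close> by simp
  have "Suc (Max S) \<notin> S" using fin Max_ge by (meson Suc_n_not_le_n)
  then have le_Max: "L \<le> real (Max S) + 1" unfolding S by simp
  have Max_less: "real (Max S) < L" using MS unfolding S by simp
  have k: "k_seq m n = nat \<lfloor>sqrt (real (Max S))\<rfloor>"
    unfolding k_seq_def S_def if_P[OF l] ..
  define s where "s = sqrt (real (Max S))"
  have s1: "1 \<le> s" unfolding s_def using M1 by simp
  have s2: "s ^ 2 = real (Max S)" unfolding s_def by simp
  have ks: "real (k_seq m n) \<le> s" "s < real (k_seq m n) + 1" "1 \<le> k_seq m n"
    unfolding k s_def[symmetric] using s1 by linarith+
  show "0 < k_seq m n" using ks by simp
  have "real (k_seq m n) ^ 2 \<le> s ^ 2" using ks by (intro power_mono) auto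
  then show "real (k_seq m n) ^ 2 \<le> L" using s2 Max_less by linarith
  \<comment> \<open>Between integers the strict inequality gains 1, which absorbs the summand in
    \<open>le_Max\<close>.\<close>
  have "Max S < (k_seq m n + 1) ^ 2"
  proof -
    have "s ^ 2 < (real (k_seq m n) + 1) ^ 2" using ks s1 by (intro power_strict_mono) auto
    then have "real (Max S) < real ((k_seq m n + 1) ^ 2)" using s2 by (simp add: add.commute)
    then show ?thesis by (simp only: of_nat_less_iff)
  qed
  then have "real (Max S + 1) \<le> real ((k_seq m n + 1) ^ 2)" by (simp only: of_nat_le_iff)
  then show "L \<le> (real (k_seq m n) + 1) ^ 2" using le_Max by (simp add: add.commute)
qed

text \<open>Made for the next lemma: at norm 5 the outermost logarithm is at least
  \<open>5 * k\<close>, and the summand 2 is \<open>log 2 4\<close>, coming from a fourth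
  power.\<close>

lemma Suc_square_le_two_power:
  assumes "1 \<le> k"
  shows "(k + 1) ^ 2 + 2 \<le> (2::nat) ^ (5 * k)"
  using assms
proof (induction k rule: dec_induct)
  case (step k)
  have "(Suc k + 1) ^ 2 + 2 \<le> 32 * ((k + 1) ^ 2 + 2)" by (simp add: power2_eq_square algebra_simps)
  also have "\<dots> \<le> 32 * 2 ^ (5 * k)" using step.IH by simp
  also have "\<dots> = (2::nat) ^ (5 * Suc k)" by (simp add: power_add)
  finally show ?case .
qed (simp add: power2_eq_square)

text \<open>Norm 5 gives \<open>log 2 (log 2 a) \<ge> 2 ^ (5 * k)\<close>. As \<open>k\<close> is
  about the square root of \<open>log 2 (log 2 L)\<close>, this exceeds
  \<open>log 2 (log 2 L) + 2\<close>; undoing two logarithms turns the summand 2 into the exponent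
  4.\<close>

lemma log_power4_le:
  assumes l: "2 ^ (2 ^ 16) < l_seq m n"
    and f: "5 \<le> f_norm (k_seq m n) a i" and i: "0 \<le> i"
  shows "log 2 (real (l_seq m n)) ^ 4 \<le> a"
proof -
  define k where "k = k_seq m n"
  define L where "L = log 2 (real (l_seq m n))"
  have "1 < f_norm k a i" using f k_def by simp
  note d = f_norm_gt_oneD[OF this]
  note kb = k_seq_bounds[OF l, folded k_def L_def]
  note ll = loglog_large[OF l, folded L_def]
  have "real k * 5 \<le> real k * f_norm k a i" using f k_def by (intro mult_left_mono) auto
  then have "real (5 * k) \<le> log 2 (log 2 (log 2 a) - i)" using d(6) by (simp add: mult.commute)
  then have "2 powr real (5 * k) \<le> log 2 (log 2 a) - i" using d(5) by (simp add: le_log_iff)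
  then have "2 ^ (5 * k) \<le> log 2 (log 2 a)"
    using i powr_realpow[of "2::real" "5 * k"] by linarith
  moreover have "(real k + 1) ^ 2 + 2 \<le> 2 ^ (5 * k)"
    using Suc_square_le_two_power[of k] kb(1)
    by (metis (mono_tags, lifting) Suc_leI One_nat_def of_nat_1 of_nat_add of_nat_le_iff of_nat_numeral of_nat_power)
  ultimately have "log 2 (log 2 L) + 2 \<le> log 2 (log 2 a)" using kb(3) by linarith
  then have "2 powr (log 2 (log 2 L) + 2) \<le> log 2 a" using d(3) by (simp add: le_log_iff)
  then have "log 2 L * 4 \<le> log 2 a" using ll by (simp add: powr_add)
  then have "log 2 (L ^ 4) \<le> log 2 a" using ll by (simp add: log_nat_power)
  then show ?thesis using ll d(2) by (simp add: L_def[symmetric])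
qed

text \<open>Cutting \<open>l + 2\<close> sets of at most \<open>l\<close> values into groups of size
  \<open>g\<close> yields at most \<open>(l + 2) * l\<close> groups, few enough for property B. The
  last bound makes \<open>(g + 1) ^ 2\<close> at most \<open>log 2 l ^ 4\<close>, the size
  guaranteed by norm 5. An odd \<open>g\<close> of order \<open>2 * log 2 l\<close> meets both
  demands.\<close>

lemma obtain_group_size:
  assumes l: "2 ^ (2 ^ 16) < (l::nat)"
  obtains g :: nat where "0 < g" "(l + 2) * l < 2 ^ (g - 1)" "real (g + 1) \<le> log 2 (real l) ^ 2"
proof -
  note ll = loglog_large[OF l]
  have l4: "4 < l"
    by (rule le_less_trans[OF _ l], rule order_trans[of _ "2 ^ 2"], simp, rule power_increasing, auto)
  define e where "e = nat \<lceil>log 2 (real (l + 2))\<rceil>"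
  have el: "log 2 (real (l + 2)) \<le> real e" unfolding e_def by linarith
  then have "real (l + 2) \<le> 2 powr real e" by (simp add: log_le_iff)
  then have "real (l + 2) \<le> real (2 ^ e)" by (simp add: powr_realpow)
  then have e1: "l + 2 \<le> 2 ^ e" by (simp only: of_nat_le_iff)
  have "log 2 (real (l + 2)) \<le> log 2 (2 * real l)" using l4 by simp
  also have "\<dots> = 1 + log 2 (real l)" using l4 by (simp add: log_mult)
  finally have "log 2 (real (l + 2)) \<le> 1 + log 2 (real l)" .
  moreover have "0 \<le> log 2 (real (l + 2))" by simp
  ultimately have e2: "real e \<le> log 2 (real l) + 2" unfolding e_def by linarith
  show thesis
  proof (rule that[of "2 * e + 1"])
    have "(l + 2) * l < (l + 2) * (l + 2)" by simp
    also have "\<dots> \<le> 2 ^ e * 2 ^ e" using e1 by (intro mult_le_mono)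
    also have "\<dots> = 2 ^ (2 * e + 1 - 1)" by (simp add: power_add[symmetric] mult_2)
    finally show "(l + 2) * l < 2 ^ (2 * e + 1 - 1)" .
    have "real (2 * e + 1 + 1) \<le> 2 * log 2 (real l) + 6" using e2 by simp
    also have "\<dots> \<le> 10 * log 2 (real l)" using ll by simp
    also have "\<dots> \<le> log 2 (real l) * log 2 (real l)" using ll by (intro mult_right_mono) auto
    finally show "real (2 * e + 1 + 1) \<le> log 2 (real l) ^ 2" by (simp add: power2_eq_square)
  qed simp
qed

section \<open>Colourings splitting many sets\<close>

text \<open>Erdos's bound for property B: a random colouring makes a set of size \<open>g\<close> monochromatic
  with probability \<open>2 ^ (1 - g)\<close>.\<close>

lemma property_B:
  assumes V: "finite V" and F: "finite F" "card F < 2 ^ (g - 1)"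
    and G: "\<And>G. G \<in> F \<Longrightarrow> G \<subseteq> V \<and> card G = g" and g: "0 < g"
  obtains h where "h \<subseteq> V" "\<And>G. G \<in> F \<Longrightarrow> G \<inter> h \<noteq> {} \<and> G - h \<noteq> {}"
proof -
  define bad where "bad G = {h \<in> Pow V. G \<inter> h = {} \<or> G \<subseteq> h}" for G
  have card_bad: "card (bad G) \<le> 2 * 2 ^ (card V - g)" if "G \<in> F" for G
  proof -
    have GV: "G \<subseteq> V" and cG: "card G = g" using G[OF that] by auto
    have "bad G \<subseteq> Pow (V - G) \<union> (\<union>) G ` Pow (V - G)"
    proof
      fix h assume h: "h \<in> bad G"
      show "h \<in> Pow (V - G) \<union> (\<union>) G ` Pow (V - G)"
      proof (cases "G \<subseteq> h")
        case True
        then have "h = G \<union> (h - G)" by blast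
        then have "h \<in> (\<union>) G ` Pow (V - G)" by (rule image_eqI) (use h in \<open>auto simp: bad_def\<close>)
        then show ?thesis by blast
      qed (use h in \<open>auto simp: bad_def\<close>)
    qed
    then have "card (bad G) \<le> card (Pow (V - G) \<union> (\<union>) G ` Pow (V - G))"
      using V by (intro card_mono) auto
    also have "\<dots> \<le> card (Pow (V - G)) + card ((\<union>) G ` Pow (V - G))" by (rule card_Un_le)
    also have "\<dots> \<le> card (Pow (V - G)) + card (Pow (V - G))"
      using V by (intro add_left_mono card_image_le) auto
    also have "\<dots> = 2 * 2 ^ (card V - g)"
      using V GV cG by (simp add: card_Pow card_Diff_subset finite_subset)
    finally show ?thesis .
  qed
  have "\<exists>h. h \<in> Pow V - \<Union>(bad ` F)"
  \<comment> \<open>A member of \<open>F\<close> is needed to get \<open>g \<le> card V\<close>, so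
    that the truncated difference \<open>card V - g\<close> is a true one.\<close>
  proof (cases "F = {}")
    case True
    then show ?thesis by auto
  next
    case False
    then obtain G0 where "G0 \<in> F" by auto
    then have gV: "g \<le> card V" using G[of G0] card_mono[OF V, of G0] by simp
    \<comment> \<open>Union bound: fewer than \<open>2 ^ card V\<close> subsets of \<open>V\<close>
      are bad for some \<open>G\<close>.\<close>
    have "card (\<Union>(bad ` F)) \<le> (\<Sum>G\<in>F. card (bad G))" by (rule card_UN_le[OF F(1)])
    also have "\<dots> \<le> card F * (2 * 2 ^ (card V - g))"
      using sum_bounded_above[of F "\<lambda>G. card (bad G)"] card_bad by simp
    also have "\<dots> < 2 ^ (g - 1) * (2 * 2 ^ (card V - g))" using F(2) by simp
    also have "\<dots> = 2 ^ ((g - 1) + 1 + (card V - g))" by (simp add: power_add)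
    also have "\<dots> = card (Pow V)" using g gV V by (simp add: card_Pow)
    finally have "card (\<Union>(bad ` F)) < card (Pow V)" .
    moreover have "finite (\<Union>(bad ` F))" using F(1) V unfolding bad_def by simp
    ultimately have "\<not> Pow V \<subseteq> \<Union>(bad ` F)" using card_mono leD by blast
    then show ?thesis by blast
  qed
  then obtain h where "h \<subseteq> V" "\<And>G. G \<in> F \<Longrightarrow> h \<notin> bad G" by auto
  then show thesis by (intro that[of h]) (auto simp: bad_def)
qed

lemma obtain_disjoint_groups:
  assumes "b * g \<le> card A" "0 < g"
  obtains G where "\<And>k. k < b \<Longrightarrow> G k \<subseteq> A \<and> card (G k) = g"
    "\<And>k k'. k < k' \<Longrightarrow> k' < b \<Longrightarrow> G k \<inter> G k' = {}"
proof -
  have "\<exists>G. (\<forall>k<b. G k \<subseteq> A \<and> card (G k) = g) \<and> (\<forall>k' k. k < k' \<longrightarrow> k' < b \<longrightarrow> G k \<inter> G k' = {})"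
    using assms(1)
  proof (induction b arbitrary: A)
    case (Suc b)
    then have "g \<le> card A" by simp
    then obtain T where T: "T \<subseteq> A" "card T = g" "finite T"
      by (rule obtain_subset_with_card_n)
    have "b * g \<le> card (A - T)" using Suc.prems T by (simp add: card_Diff_subset)
    from Suc.IH[OF this] obtain G where
      G: "\<forall>k<b. G k \<subseteq> A - T \<and> card (G k) = g" "\<forall>k' k. k < k' \<longrightarrow> k' < b \<longrightarrow> G k \<inter> G k' = {}"
      by blast
    have "(\<forall>k<Suc b. (G(b := T)) k \<subseteq> A \<and> card ((G(b := T)) k) = g) \<and>
      (\<forall>k' k. k < k' \<longrightarrow> k' < Suc b \<longrightarrow> (G(b := T)) k \<inter> (G(b := T)) k' = {})"
      using G T by (auto simp: less_Suc_eq)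
    then show ?case by blast
  qed simp
  then show thesis using that by blast
qed

text \<open>Choosing a point of \<open>B\<close> in each group is injective, since the groups are
  disjoint.\<close>

lemma card_transversal_ge:
  assumes "finite B" "\<And>k. k < b \<Longrightarrow> G k \<inter> B \<noteq> {}"
    and "\<And>k k'. k < k' \<Longrightarrow> k' < b \<Longrightarrow> G k \<inter> G k' = {}"
  shows "b \<le> card B"
proof -
  have "\<forall>k. \<exists>c. k < b \<longrightarrow> c \<in> G k \<inter> B" using assms(2) by blast
  then obtain c where c: "\<And>k. k < b \<Longrightarrow> c k \<in> G k \<inter> B" by metis
  have "inj_on c {..<b}"
  proof (rule linorder_inj_onI)
    fix k k' assume "k < k'" "k \<in> {..<b}" "k' \<in> {..<b}"
    then show "c k \<noteq> c k'" using c[of k] c[of k'] assms(3)[of k k'] by auto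
  qed auto
  then have "card {..<b} \<le> card B"
    using c assms(1) by (intro card_inj_on_le) auto
  then show ?thesis by simp
qed

text \<open>With \<open>s = sqrt a \<ge> g + 1\<close> one has \<open>s * (s - g) \<ge> g\<close>,
  that is, \<open>a / g \<ge> s + 1\<close>; rounding down loses less than 1.\<close>

lemma sqrt_le_div:
  assumes "(g + 1) ^ 2 \<le> (a::nat)" "0 < g"
  shows "sqrt (real a) \<le> real (a div g)"
proof -
  define s where "s = sqrt (real a)"
  have "real ((g + 1) ^ 2) \<le> real a" using assms(1) by (simp only: of_nat_le_iff)
  then have s: "real g + 1 \<le> s" unfolding s_def by (intro real_le_rsqrt) (simp add: add.commute)
  have sa: "s * s = real a" unfolding s_def by simp
  have "real g * 1 \<le> s * (s - real g)" using s by (intro mult_mono) auto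
  then have "real g * (s + 1) \<le> real a" using sa by (simp add: algebra_simps)
  then have "s + 1 \<le> real a / real g" using assms(2) by (simp add: field_simps)
  moreover have "real a / real g < real (a div g) + 1"
    using assms(2) by (metis floor_divide_of_nat_eq of_int_of_nat_eq real_of_int_floor_add_one_gt)
  ultimately show ?thesis unfolding s_def by linarith
qed

text \<open>Cut each \<open>A j\<close> into \<open>card (A j) div g\<close> disjoint groups and
  apply property B to all groups together. Each colour meets every group, so it has at least that
  many points in \<open>A j\<close>, and this number is at least the square root.\<close>

lemma obtain_splitting_set:
  fixes A :: "nat \<Rightarrow> nat set"
  assumes A: "\<And>j. j < B \<Longrightarrow> A j \<subseteq> {..<N}" "\<And>j. j < B \<Longrightarrow> (g + 1) ^ 2 \<le> card (A j)"
    and B: "B * N < 2 ^ (g - 1)" and g: "0 < g"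
  obtains h where
    "\<And>j. j < B \<Longrightarrow> sqrt (real (card (A j))) \<le> real (card (A j \<inter> h))"
    "\<And>j. j < B \<Longrightarrow> sqrt (real (card (A j))) \<le> real (card (A j - h))"
proof -
  have "\<exists>G. (\<forall>k<card (A j) div g. G k \<subseteq> A j \<and> card (G k) = g) \<and>
    (\<forall>k k'. k < k' \<longrightarrow> k' < card (A j) div g \<longrightarrow> G k \<inter> G k' = {})" for j
    by (rule obtain_disjoint_groups[OF div_times_less_eq_dividend g, of "A j"]) blast
  then obtain G where G: "\<And>j k. k < card (A j) div g \<Longrightarrow> G j k \<subseteq> A j \<and> card (G j k) = g"
    and Gd: "\<And>j k k'. k < k' \<Longrightarrow> k' < card (A j) div g \<Longrightarrow> G j k \<inter> G j k' = {}"
    by metis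
  have fA: "finite (A j)" "card (A j) \<le> N" if "j < B" for j
    using A(1)[OF that] finite_subset card_mono[OF _ A(1)[OF that]] by auto
  define I where "I = (SIGMA j:{..<B}. {..<card (A j) div g})"
  have "card I = (\<Sum>j<B. card (A j) div g)" unfolding I_def by simp
  \<comment> \<open>A crude count suffices: there are at most as many groups as elements.\<close>
  also have "\<dots> \<le> (\<Sum>j<B. N)"
    by (rule sum_mono) (use fA in \<open>auto intro: order_trans[OF div_le_dividend]\<close>)
  finally have "card I \<le> B * N" by simp
  moreover have "finite I" unfolding I_def by auto
  ultimately have F: "card (case_prod G ` I) < 2 ^ (g - 1)" "finite (case_prod G ` I)"
    using card_image_le[of I "case_prod G"] B by auto
  obtain h where h: "h \<subseteq> {..<N}"
    "\<And>X. X \<in> case_prod G ` I \<Longrightarrow> X \<inter> h \<noteq> {} \<and> X - h \<noteq> {}"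
  proof (rule property_B[of "{..<N}" "case_prod G ` I" g])
    show "X \<subseteq> {..<N} \<and> card X = g" if "X \<in> case_prod G ` I" for X
      using that G A(1) unfolding I_def by fastforce
  qed (use F g in auto)
  have hG: "G j k \<inter> h \<noteq> {}" "G j k - h \<noteq> {}" if "j < B" "k < card (A j) div g" for j k
    using h(2)[of "G j k"] that unfolding I_def by force+
  show thesis
  proof (rule that[of h])
    fix j assume j: "j < B"
    have s: "sqrt (real (card (A j))) \<le> real (card (A j) div g)"
      using sqrt_le_div A(2)[OF j] g by blast
    have "card (A j) div g \<le> card (A j \<inter> h)"
      by (rule card_transversal_ge[of _ _ "G j"]) (use fA(1)[OF j] in simp, use G hG(1)[OF j] in blast, rule Gd)
    then show "sqrt (real (card (A j))) \<le> real (card (A j \<inter> h))" using s by linarith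
    have "card (A j) div g \<le> card (A j - h)"
      by (rule card_transversal_ge[of _ _ "G j"]) (use fA(1)[OF j] in simp, use G hG(2)[OF j] in blast, rule Gd)
    then show "sqrt (real (card (A j))) \<le> real (card (A j - h))" using s by linarith
  qed
qed

section \<open>Countability in a generic extension\<close>

context
  fixes P :: "'p set" and le :: "'p \<Rightarrow> 'p \<Rightarrow> bool"
  assumes forcing: "forcing_notion P le"
begin

lemma forcing_refl: "p \<in> P \<Longrightarrow> le p p"
  using forcing unfolding forcing_notion_def by blast

lemma forcing_trans: "le p q \<Longrightarrow> le q r \<Longrightarrow> p \<in> P \<Longrightarrow> q \<in> P \<Longrightarrow> r \<in> P \<Longrightarrow> le p r"
  using forcing unfolding forcing_notion_def by blast

text \<open>Since \<open>f_ex\<close> unfolds to not-all-not, witnesses need only be dense below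
  \<open>p\<close>.\<close>

lemma f_exI:
  assumes "\<And>q. q \<in> P \<Longrightarrow> le p q \<Longrightarrow> \<exists>x\<in>A. \<exists>r\<in>P. le q r \<and> \<phi> x r"
  shows "f_ex P le A \<phi> p"
  using assms unfolding f_ex_def f_not_def f_all_def by blast

lemma f_imp_eqI:
  assumes "\<And>q. q \<in> P \<Longrightarrow> le p q \<Longrightarrow> \<phi> q \<Longrightarrow> x = y"
  shows "f_imp P le \<phi> (f_eq x y) p"
  using assms forcing_refl unfolding f_imp_def f_not_def f_and_def f_eq_def by blast

lemma f_memD:
  assumes "f_mem P le x \<tau> p" "q \<in> P" "le p q"
  obtains r s where "r \<in> P" "le q r" "(x, s) \<in> \<tau>" "le s r"
  using assms unfolding f_mem_def by blast

text \<open>Read \<open>D n x q\<close> as ``\<open>q\<close> decides the \<open>n\<close>-th term of a (partial) sequence of ground model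
  elements to be \<open>x\<close>''. The name used for the injection sends \<open>x\<close> to the least \<open>n\<close> whose term
  is \<open>x\<close>.\<close>

lemma f_countable_if_dense_decisions:
  fixes D :: "nat \<Rightarrow> 'x \<Rightarrow> 'p \<Rightarrow> bool"
  assumes mono: "\<And>n x q r. D n x q \<Longrightarrow> q \<in> P \<Longrightarrow> r \<in> P \<Longrightarrow> le q r \<Longrightarrow> D n x r"
    and functional: "\<And>n x x' q. q \<in> P \<Longrightarrow> D n x q \<Longrightarrow> D n x' q \<Longrightarrow> x = x'"
    and dense: "\<And>x q. x \<in> X \<Longrightarrow> q \<in> P \<Longrightarrow> \<exists>n. \<exists>r\<in>P. le q r \<and> D n x r"
    and p: "p \<in> P"
  shows "f_countable P le X p"
proof -
  \<comment> \<open>Earlier terms are excluded on all extensions of \<open>q\<close>, not just at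
    \<open>q\<close>; otherwise a stronger condition could decide an earlier term to be
    \<open>x\<close>.\<close>
  define least where "least n x q \<longleftrightarrow> D n x q \<and> (\<forall>n'<n. \<forall>r\<in>P. le q r \<longrightarrow> \<not> D n' x r)" for n x q
  define \<tau> where "\<tau> = {((x, n), q) | x n q. x \<in> X \<and> q \<in> P \<and> least n x q}"
  have \<tau>: "\<tau> \<in> subset_names P (X \<times> UNIV)"
    unfolding subset_names_def \<tau>_def by auto
  have dense_least: "\<exists>n. \<exists>r\<in>P. le q r \<and> least n x r" if x: "x \<in> X" and q: "q \<in> P" for x q
  proof -
    let ?Q = "\<lambda>n. \<exists>r\<in>P. le q r \<and> D n x r"
    \<comment> \<open>Minimality is taken over all extensions of \<open>q\<close>, so no extension
      of the chosen \<open>r\<close> can decide an earlier term to be \<open>x\<close>.\<close>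
    obtain n where n: "?Q n" "\<And>n'. n' < n \<Longrightarrow> \<not> ?Q n'"
      using dense[OF x q] exists_least_iff[of ?Q] by blast
    then obtain r where "r \<in> P" "le q r" "D n x r" by blast
    then have "least n x r"
      unfolding least_def using n(2) forcing_trans[of q r] q \<open>r \<in> P\<close> by blast
    then show ?thesis using \<open>r \<in> P\<close> \<open>le q r\<close> by blast
  qed
  have least_mono: "least n x r" if q: "least n x q" "q \<in> P" "r \<in> P" "le q r" for n x q r
  proof -
    have "D n x r" using q mono[of n x q r] unfolding least_def by blast
    moreover have "\<not> D n' x r'" if "n' < n" "r' \<in> P" "le r r'" for n' r'
      using q that forcing_trans[of q r r'] unfolding least_def by blast
    ultimately show ?thesis unfolding least_def by blast
  qed
  have mem: "\<exists>r\<in>P. le q r \<and> least n x r"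
    if pq: "f_mem P le (x, n) \<tau> p" "q \<in> P" "le p q" for x n p q
  proof -
    obtain r s where rs: "r \<in> P" "le q r" "((x, n), s) \<in> \<tau>" "le s r" using f_memD[OF pq] by blast
    then have s: "s \<in> P" "least n x s" unfolding \<tau>_def by auto
    then show ?thesis using rs least_mono by blast
  qed
  have both: "\<exists>r\<in>P. least n x r \<and> least n' x' r"
    if q: "f_and (f_mem P le (x, n) \<tau>) (f_mem P le (x', n') \<tau>) q" "q \<in> P" for x n x' n' q
  proof -
    obtain r where r: "r \<in> P" "le q r" "least n x r"
      using mem[of x n q q] q forcing_refl unfolding f_and_def by blast
    then obtain r' where "r' \<in> P" "le r r'" "least n' x' r'"
      using mem[of x' n' q r] q unfolding f_and_def by blast
    then show ?thesis using r least_mono[of n x r r'] by blast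
  qed
  have total: "f_all X (\<lambda>x. f_ex P le UNIV (\<lambda>n. f_mem P le (x, n) \<tau>)) p'" for p'
    unfolding f_all_def
  proof (intro ballI f_exI)
    fix x q assume x: "x \<in> X" and q: "q \<in> P"
    obtain n r where r: "r \<in> P" "le q r" "least n x r" using dense_least[OF x q] by blast
    have "((x, n), r) \<in> \<tau>" using r x unfolding \<tau>_def by blast
    then have "f_mem P le (x, n) \<tau> r" using forcing_refl unfolding f_mem_def by blast
    then show "\<exists>n\<in>UNIV. \<exists>r\<in>P. le q r \<and> f_mem P le (x, n) \<tau> r" using r by blast
  qed
  have single: "f_all X (\<lambda>x. f_all UNIV (\<lambda>n. f_all UNIV (\<lambda>n'.
      f_imp P le (f_and (f_mem P le (x, n) \<tau>) (f_mem P le (x, n') \<tau>)) (f_eq n n')))) p'" for p'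
    unfolding f_all_def
  proof (intro ballI f_imp_eqI)
    fix x n n' q
    assume "q \<in> P" "f_and (f_mem P le (x, n) \<tau>) (f_mem P le (x, n') \<tau>) q"
    then obtain r where "r \<in> P" "least n x r" "least n' x r" using both by blast
    then show "n = n'" using forcing_refl unfolding least_def by (meson linorder_neqE_nat)
  qed
  have inj: "f_all X (\<lambda>x. f_all X (\<lambda>x'. f_all UNIV (\<lambda>n.
      f_imp P le (f_and (f_mem P le (x, n) \<tau>) (f_mem P le (x', n) \<tau>)) (f_eq x x')))) p'" for p'
    unfolding f_all_def
  proof (intro ballI f_imp_eqI)
    fix x x' n q
    assume "q \<in> P" "f_and (f_mem P le (x, n) \<tau>) (f_mem P le (x', n) \<tau>) q"
    then obtain r where "r \<in> P" "least n x r" "least n x' r" using both by blast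
    then show "x = x'" using functional unfolding least_def by blast
  qed
  show ?thesis
    unfolding f_countable_def
    by (rule f_exI, rule bexI[OF _ \<tau>], rule bexI)
      (simp_all only: f_and_def total single inj forcing_refl simp_thms)
qed

end

section \<open>The creatures and their conditions\<close>

lemma finite_H_seq: "finite (H_seq m n)"
  by (simp add: H_seq_def)

lemma H_seq_eq_lessThan: "H_seq m n = {..<l_seq m n}"
  by (auto simp: H_seq_def l_seq_def)

lemma l_seq_ge_two: "2 \<le> l_seq m n"
  by (simp add: l_seq_def H_seq_def)

lemma seqs_H_seq_nonempty: "seqs (H_seq m) n \<noteq> {}"
proof -
  have "replicate n 0 \<in> seqs (H_seq m) n" by (simp add: seqs_def H_seq_def)
  then show ?thesis by blast
qed

text \<open>A normal form: the \<open>dis\<close> component of a member of \<open>K_pair\<close>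
  determines its norm and its values, so \<open>K_pair\<close> is parametrized by the admissible
  triples.\<close>

definition simple_creature :: "(nat \<Rightarrow> nat) \<Rightarrow> nat \<Rightarrow> nat set \<Rightarrow> nat \<Rightarrow> creature0" where
  "simple_creature m n A i = Creature (f_norm (k_seq m n) (real (card A)) (real i))
     {(u, u @ [a]) | u a. u \<in> seqs (H_seq m) n \<and> a \<in> A} (n, A, i)"

definition admissible :: "(nat \<Rightarrow> nat) \<Rightarrow> nat \<Rightarrow> nat set \<Rightarrow> nat \<Rightarrow> bool" where
  "admissible m n A i \<longleftrightarrow> A \<noteq> {} \<and> A \<subseteq> H_seq m n \<and> real i \<le> log 2 (log 2 (real (l_seq m n)))"

definition pos_set :: "creature0 \<Rightarrow> nat set" where
  "pos_set t = fst (snd (dis t))"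

lemma simple_creature_sel [simp]:
  "nor (simple_creature m n A i) = f_norm (k_seq m n) (real (card A)) (real i)"
  "dis (simple_creature m n A i) = (n, A, i)"
  "pos_set (simple_creature m n A i) = A"
  by (simp_all add: simple_creature_def pos_set_def)

lemma val_simple_creature:
  "(u, v) \<in> val (simple_creature m n A i) \<longleftrightarrow> u \<in> seqs (H_seq m) n \<and> (\<exists>a\<in>A. v = u @ [a])"
  by (auto simp: simple_creature_def)

lemma levels_simple_creature:
  assumes "A \<noteq> {}"
  shows "m_dn (simple_creature m n A i) = n" "m_up (simple_creature m n A i) = Suc n"
proof -
  obtain u a where ua: "u \<in> seqs (H_seq m) n" "a \<in> A"
    using seqs_H_seq_nonempty assms by blast
  then have "(u, u @ [a]) \<in> val (simple_creature m n A i)" by (simp add: val_simple_creature)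
  moreover have "length u = n" using ua by (simp add: seqs_def)
  moreover have "length u = n \<and> length v = Suc n" if "(u, v) \<in> val (simple_creature m n A i)" for u v
    using that by (auto simp: val_simple_creature seqs_def)
  ultimately show "m_dn (simple_creature m n A i) = n" "m_up (simple_creature m n A i) = Suc n"
    unfolding m_dn_def m_up_def by (auto intro!: the_equality)
qed

lemma simple_creature_in_K_pair:
  assumes "admissible m n A i"
  shows "simple_creature m n A i \<in> K_pair m"
proof -
  let ?t = "simple_creature m n A i"
  have A: "A \<noteq> {}" "A \<subseteq> H_seq m n" using assms by (auto simp: admissible_def)
  have "val ?t \<subseteq> transitions (H_seq m) n (Suc n)"
    using A(2) by (auto simp: val_simple_creature transitions_def seqs_def nth_append less_Suc_eq; blast)
  moreover have "val ?t \<noteq> {}"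
    using A seqs_H_seq_nonempty[of m n] unfolding simple_creature_def by auto
  moreover have "0 \<le> nor ?t"
    by (simp add: f_norm_nonneg)
  ultimately have "?t \<in> CR (H_seq m)" unfolding CR_def by blast
  moreover have "has_pos (H_seq m) ?t A"
    using levels_simple_creature(1)[OF A(1), of m n i] unfolding has_pos_def by (simp add: simple_creature_def)
  ultimately show ?thesis
    using assms levels_simple_creature[OF A(1), of m n i] unfolding K_pair_def admissible_def by simp
qed

lemma K_pairE:
  assumes "t \<in> K_pair m"
  obtains n A i where "admissible m n A i" "t = simple_creature m n A i"
proof -
  obtain n A i where t: "dis t = (n, A, i)" "A \<noteq> {}" "A \<subseteq> H_seq m n"
    "real i \<le> log 2 (log 2 (real (l_seq m n)))"
    "nor t = f_norm (k_seq m n) (real (card A)) (real i)"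
    "m_dn t = n" "has_pos (H_seq m) t A"
    using assms unfolding K_pair_def by blast
  then have "t = simple_creature m n A i"
    unfolding simple_creature_def has_pos_def by (cases t) simp
  then show thesis using t by (intro that) (auto simp: admissible_def)
qed

lemma K_pair_eq: "t \<in> K_pair m \<longleftrightarrow> (\<exists>n A i. admissible m n A i \<and> t = simple_creature m n A i)"
  using simple_creature_in_K_pair by (blast elim: K_pairE)

lemma admissible_nonempty: "admissible m n A i \<Longrightarrow> A \<noteq> {}"
  by (simp add: admissible_def)

lemma admissible_mono:
  "admissible m n A i \<Longrightarrow> B \<subseteq> A \<Longrightarrow> B \<noteq> {} \<Longrightarrow> admissible m n B i"
  by (auto simp: admissible_def)

lemma Sigma_pair_simple_creature:
  "s \<in> Sigma_pair m (simple_creature m n A i) \<longleftrightarrow>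
    (\<exists>B j. admissible m n B j \<and> s = simple_creature m n B j \<and> B \<subseteq> A \<and> i \<le> j)"
  unfolding Sigma_pair_def K_pair_eq by (auto; blast)

lemma Sigma_pairD:
  assumes "s \<in> Sigma_pair m t" "t \<in> K_pair m"
  shows "s \<in> K_pair m" "m_dn s = m_dn t" "pos_set s \<subseteq> pos_set t" "val s \<subseteq> val t"
    "Sigma_pair m s \<subseteq> Sigma_pair m t"
proof -
  obtain n A i where t: "admissible m n A i" "t = simple_creature m n A i"
    using assms(2) by (rule K_pairE)
  then obtain B j where s: "admissible m n B j" "s = simple_creature m n B j" "B \<subseteq> A" "i \<le> j"
    using assms(1) Sigma_pair_simple_creature by blast
  show "s \<in> K_pair m" using s simple_creature_in_K_pair by blast
  show "m_dn s = m_dn t" using s t levels_simple_creature admissible_nonempty by metis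
  show "pos_set s \<subseteq> pos_set t" using s t by simp
  show "val s \<subseteq> val t" using s(3) unfolding s(2) t(2) simple_creature_def by auto
  show "Sigma_pair m s \<subseteq> Sigma_pair m t"
    unfolding s(2) t(2) using s(3,4) Sigma_pair_simple_creature by (meson order_trans subsetI)
qed

lemma Sigma_pair_refl: "t \<in> K_pair m \<Longrightarrow> t \<in> Sigma_pair m t"
  using Sigma_pair_simple_creature by (elim K_pairE) blast

lemma pos_set_nonempty: "t \<in> K_pair m \<Longrightarrow> pos_set t \<noteq> {}"
  using admissible_nonempty by (auto elim!: K_pairE)

lemma m_up_K_pair: "t \<in> K_pair m \<Longrightarrow> m_up t = Suc (m_dn t)"
  using levels_simple_creature admissible_nonempty by (metis K_pairE)

lemma val_K_pair:
  "t \<in> K_pair m \<Longrightarrow>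
    (u, v) \<in> val t \<longleftrightarrow> u \<in> seqs (H_seq m) (m_dn t) \<and> (\<exists>a\<in>pos_set t. v = u @ [a])"
  by (erule K_pairE) (simp add: val_simple_creature levels_simple_creature admissible_def)

section \<open>Structural properties of the creating pair\<close>

lemma good_creating_pair_K_pair: "good_creating_pair (H_seq m) (K_pair m) (Sigma_pair m)"
  unfolding good_creating_pair_def
proof (intro conjI allI ballI)
  show "K_pair m \<subseteq> CR (H_seq m)" unfolding K_pair_def by blast
  show "2 \<le> card (H_seq m n)" for n using l_seq_ge_two by (simp add: l_seq_def)
  fix t assume t: "t \<in> K_pair m"
  show "Domain (val t) = seqs (H_seq m) (m_dn t)"
    using val_K_pair[OF t] pos_set_nonempty[OF t] by (auto simp: Domain_iff)
  show "Sigma_pair m t \<subseteq> K_pair m" unfolding Sigma_pair_def by blast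
  show "t \<in> Sigma_pair m t" by (rule Sigma_pair_refl[OF t])
  show "val s \<subseteq> val t" "Sigma_pair m s \<subseteq> Sigma_pair m t" if "s \<in> Sigma_pair m t" for s
    using Sigma_pairD[OF that t] by blast+
qed (rule finite_H_seq)

lemma local_creatures_K_pair: "local_creatures (K_pair m)"
  by (simp add: local_creatures_def m_up_K_pair[of _ m])

lemma forgetful_K_pair: "forgetful (H_seq m) (K_pair m)"
  unfolding forgetful_def
proof (intro ballI impI)
  fix t u v
  assume t: "t \<in> K_pair m" and u: "u \<in> seqs (H_seq m) (m_dn t)"
    and "(take (m_dn t) v, v) \<in> val t"
  then obtain a where a: "a \<in> pos_set t" "v = take (m_dn t) v @ [a]"
    using val_K_pair[OF t] by blast
  then have "drop (m_dn t) v = [a]" by (metis append_take_drop_id same_append_eq)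
  then show "(u, u @ drop (m_dn t) v) \<in> val t" using val_K_pair[OF t] u a by auto
qed

lemma strongly_finitary_K_pair: "strongly_finitary (H_seq m) (K_pair m)"
  unfolding strongly_finitary_def
proof (intro allI conjI finite_H_seq)
  fix n
  \<comment> \<open>The bound on \<open>i\<close> in \<open>admissible\<close> leaves finitely many
    pairs \<open>(A, i)\<close> at level \<open>n\<close>.\<close>
  define b where "b = nat \<lceil>log 2 (log 2 (real (l_seq m n)))\<rceil>"
  have "{t \<in> K_pair m. m_dn t = n} \<subseteq> case_prod (simple_creature m n) ` (Pow (H_seq m n) \<times> {..b})"
  proof
    fix t assume t: "t \<in> {t \<in> K_pair m. m_dn t = n}"
    then have "t \<in> K_pair m" by simp
    then obtain n' A i where A: "admissible m n' A i" "t = simple_creature m n' A i"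
      by (rule K_pairE)
    have n': "n' = n" using t A by (simp add: levels_simple_creature admissible_def)
    have "i \<le> b" using A(1) unfolding n' admissible_def b_def by linarith
    then have "(A, i) \<in> Pow (H_seq m n) \<times> {..b}" using A(1) n' by (simp add: admissible_def)
    then show "t \<in> case_prod (simple_creature m n) ` (Pow (H_seq m n) \<times> {..b})"
      by (rule rev_image_eqI) (simp add: A(2) n')
  qed
  then show "finite {t \<in> K_pair m. m_dn t = n}"
    by (rule finite_subset) (simp add: finite_H_seq)
qed

section \<open>Conditions, their branches and their order\<close>

lemma Q_inftyI:
  assumes "\<And>n. t n \<in> K_pair m" "\<And>n. m_dn (t n) = length w + n"
    "w \<in> seqs (H_seq m) (length w)" "filterlim (\<lambda>n. nor (t n)) at_top sequentially"
  shows "(w, t) \<in> Q_infty (H_seq m) (K_pair m)"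
  using assms by (simp add: Q_infty_def m_up_K_pair[of _ m])

lemma Q_inftyD:
  assumes "(w, t) \<in> Q_infty (H_seq m) (K_pair m)"
  shows "t n \<in> K_pair m" "m_dn (t n) = length w + n" "w \<in> seqs (H_seq m) (length w)"
    "filterlim (\<lambda>n. nor (t n)) at_top sequentially"
proof -
  show K: "t n \<in> K_pair m" for n using assms by (simp add: Q_infty_def)
  have w: "w \<in> seqs (H_seq m) (m_dn (t 0))" using assms by (simp add: Q_infty_def)
  then have l: "length w = m_dn (t 0)" by (simp add: seqs_def)
  show "w \<in> seqs (H_seq m) (length w)" using w l by simp
  show "m_dn (t n) = length w + n"
  proof (induction n)
    case (Suc n)
    have "m_dn (t (Suc n)) = m_up (t n)" using assms by (simp add: Q_infty_def)
    then show ?case using Suc m_up_K_pair[OF K] by simp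
  qed (simp add: l)
  show "filterlim (\<lambda>n. nor (t n)) at_top sequentially" using assms by (simp add: Q_infty_def)
qed

lemma take_in_seqs: "v \<in> seqs H n \<Longrightarrow> k \<le> n \<Longrightarrow> take k v \<in> seqs H k"
  by (auto simp: seqs_def)

text \<open>The creatures are local and their values ignore the past, so possibilities are described
  one coordinate at a time.\<close>

lemma pos_seq_iff:
  assumes "(w, t) \<in> Q_infty (H_seq m) (K_pair m)"
  shows "v \<in> pos_seq (H_seq m) w t i \<longleftrightarrow>
    v \<in> seqs (H_seq m) (length w + i) \<and> prefix w v \<and> (\<forall>n<i. v ! (length w + n) \<in> pos_set (t n))"
proof (cases i)
  case 0
  have "v = w" if "length v = length w" "prefix w v" using that by (auto simp: prefix_def)
  then show ?thesis using 0 Q_inftyD(3)[OF assms] by (auto simp: pos_seq_def seqs_def)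
next
  case (Suc k)
  note D = Q_inftyD[OF assms]
  have up: "m_up (t n) = Suc (length w + n)" for n using m_up_K_pair[OF D(1)] D(2) by simp
  have "(take (m_dn (t n)) v, take (m_up (t n)) v) \<in> val (t n) \<longleftrightarrow> v ! (length w + n) \<in> pos_set (t n)"
    if v: "v \<in> seqs (H_seq m) (length w + i)" and n: "n < i" for n
  proof -
    have "take (length w + n) v \<in> seqs (H_seq m) (length w + n)" using take_in_seqs[OF v] n by simp
    moreover have "length w + n < length v" using v n by (simp add: seqs_def)
    ultimately show ?thesis
      using val_K_pair[OF D(1)] up D(2) by (simp add: take_Suc_conv_app_nth)
  qed
  then show ?thesis using Suc up[of k] by (auto simp: pos_seq_def)
qed

text \<open>The branches of a condition form a product, and these are its factors; on the trunk a
  factor is a singleton.\<close>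

definition allowed :: "(nat, nat \<times> nat set \<times> nat) cond \<Rightarrow> nat \<Rightarrow> nat set" where
  "allowed p n = (if n < length (fst p) then {fst p ! n} else pos_set (snd p (n - length (fst p))))"

lemma allowed_nonempty:
  "p \<in> Q_infty (H_seq m) (K_pair m) \<Longrightarrow> allowed p n \<noteq> {}"
  using Q_inftyD(1)[of "fst p" "snd p"] pos_set_nonempty unfolding allowed_def by auto

lemma Q_le_iff:
  assumes "p \<in> Q_infty (H_seq m) (K_pair m)" "q \<in> Q_infty (H_seq m) (K_pair m)"
  shows "Q_le (H_seq m) (Sigma_pair m) p q \<longleftrightarrow>
    (\<exists>i. length (fst q) = length (fst p) + i \<and> prefix (fst p) (fst q) \<and>
      (\<forall>n<i. fst q ! (length (fst p) + n) \<in> pos_set (snd p n)) \<and>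
      (\<forall>n. snd q n \<in> Sigma_pair m (snd p (n + i))))"
proof -
  have pq: "(fst p, snd p) \<in> Q_infty (H_seq m) (K_pair m)" "(fst q, snd q) \<in> Q_infty (H_seq m) (K_pair m)"
    using assms by simp_all
  have "fst q \<in> seqs (H_seq m) k \<longleftrightarrow> length (fst q) = k" for k
    using Q_inftyD(3)[OF pq(2)] by (auto simp: seqs_def)
  then show ?thesis unfolding Q_le_def pos_seq_iff[OF pq(1)] by blast
qed

lemma Q_le_refl:
  assumes "p \<in> Q_infty (H_seq m) (K_pair m)"
  shows "Q_le (H_seq m) (Sigma_pair m) p p"
  unfolding Q_le_iff[OF assms assms]
  using Q_inftyD(1)[of "fst p" "snd p"] assms Sigma_pair_refl by (intro exI[of _ 0]) auto

lemma Q_le_trans: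
  assumes Q: "p \<in> Q_infty (H_seq m) (K_pair m)" "q \<in> Q_infty (H_seq m) (K_pair m)"
    "r \<in> Q_infty (H_seq m) (K_pair m)"
    and pq: "Q_le (H_seq m) (Sigma_pair m) p q" and qr: "Q_le (H_seq m) (Sigma_pair m) q r"
  shows "Q_le (H_seq m) (Sigma_pair m) p r"
proof -
  obtain i where i: "length (fst q) = length (fst p) + i" "prefix (fst p) (fst q)"
    "\<And>n. n < i \<Longrightarrow> fst q ! (length (fst p) + n) \<in> pos_set (snd p n)"
    "\<And>n. snd q n \<in> Sigma_pair m (snd p (n + i))"
    using pq unfolding Q_le_iff[OF Q(1,2)] by blast
  obtain j where j: "length (fst r) = length (fst q) + j" "prefix (fst q) (fst r)"
    "\<And>n. n < j \<Longrightarrow> fst r ! (length (fst q) + n) \<in> pos_set (snd q n)"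
    "\<And>n. snd r n \<in> Sigma_pair m (snd q (n + j))"
    using qr unfolding Q_le_iff[OF Q(2,3)] by blast
  have K: "snd p n \<in> K_pair m" for n using Q_inftyD(1)[of "fst p" "snd p"] Q(1) by simp
  show ?thesis
    unfolding Q_le_iff[OF Q(1,3)]
  proof (intro exI[of _ "i + j"] conjI allI impI)
    show "prefix (fst p) (fst r)" using i(2) j(2) by (rule prefix_order.trans)
    fix n
    show "fst r ! (length (fst p) + n) \<in> pos_set (snd p n)" if n: "n < i + j"
    \<comment> \<open>Below \<open>i\<close> the value was already fixed in the trunk of
      \<open>q\<close>; from \<open>i\<close> on it lies in a set of \<open>q\<close>, which is
      contained in the corresponding set of \<open>p\<close>.\<close>
    proof (cases "n < i")
      case True
      then have "fst r ! (length (fst p) + n) = fst q ! (length (fst p) + n)"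
        using j(2) i(1) by (auto simp: prefix_def nth_append)
      then show ?thesis using i(3) True by simp
    next
      case False
      then obtain n' where n': "n = i + n'" using le_Suc_ex linorder_not_less by blast
      then have "fst r ! (length (fst p) + n) \<in> pos_set (snd q n')"
        using j(3)[of n'] n i(1) by (simp add: add.assoc)
      moreover have "pos_set (snd q n') \<subseteq> pos_set (snd p n)"
        using Sigma_pairD(3)[OF i(4) K, of n'] n' by (simp add: add.commute)
      ultimately show ?thesis by blast
    qed
    have "Sigma_pair m (snd q (n + j)) \<subseteq> Sigma_pair m (snd p (n + j + i))"
      by (rule Sigma_pairD(5)[OF i(4) K])
    then have "snd r n \<in> Sigma_pair m (snd p (n + j + i))" using j(4)[of n] by blast
    then show "snd r n \<in> Sigma_pair m (snd p (n + (i + j)))" by (simp add: ac_simps)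
  qed (use i(1) j(1) in simp)
qed

lemma allowed_antimono:
  assumes Q: "p \<in> Q_infty (H_seq m) (K_pair m)" "q \<in> Q_infty (H_seq m) (K_pair m)"
    and pq: "Q_le (H_seq m) (Sigma_pair m) p q"
  shows "allowed q n \<subseteq> allowed p n"
proof -
  obtain i where i: "length (fst q) = length (fst p) + i" "prefix (fst p) (fst q)"
    "\<And>n. n < i \<Longrightarrow> fst q ! (length (fst p) + n) \<in> pos_set (snd p n)"
    "\<And>n. snd q n \<in> Sigma_pair m (snd p (n + i))"
    using pq unfolding Q_le_iff[OF Q] by blast
  have K: "snd p n \<in> K_pair m" for n using Q_inftyD(1)[of "fst p" "snd p"] Q(1) by simp
  \<comment> \<open>The cases are the trunk of \<open>p\<close>, the part of the trunk of
    \<open>q\<close> beyond it, and the common tail.\<close>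
  consider "n < length (fst p)" | k where "n = length (fst p) + k" "k < i"
    | k where "n = length (fst p) + (k + i)"
    by (metis add.commute add_less_cancel_left le_Suc_ex linorder_not_less)
  then show ?thesis
  proof cases
    case 1
    then show ?thesis using i(1,2) by (auto simp: allowed_def prefix_def nth_append)
  next
    case 2
    then show ?thesis using i(1,3) by (simp add: allowed_def)
  next
    case 3
    then show ?thesis using i(1) Sigma_pairD(3)[OF i(4) K, of k] by (simp add: allowed_def)
  qed
qed

section \<open>The block structure\<close>

locale block_sequence =
  fixes m :: "nat \<Rightarrow> nat"
  assumes strict_mono: "strict_mono m" and zero: "m 0 = 0"
    and gap: "\<And>i. 4 ^ (i + 3) < m (Suc i) - m i"
begin

lemma obtain_block:
  obtains i where "m i \<le> n" "n < m (Suc i)"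
proof -
  have "n < m (Suc n)"
    using strict_mono_imp_increasing[OF strict_mono, of "Suc n"] by simp
  moreover have "\<not> n < m 0" by (simp add: zero)
  ultimately obtain k where "\<forall>i\<le>k. \<not> n < m i" "n < m (Suc k)"
    using ex_least_nat_less[of "\<lambda>k. n < m k" "Suc n"] by blast
  then show thesis by (intro that[of k]) auto
qed

lemma block_eqI:
  assumes "m i \<le> n" "n < m (Suc i)" "m k \<le> n" "n < m (Suc k)"
  shows "i = k"
proof -
  have "m i < m (Suc k)" "m k < m (Suc i)" using assms by simp_all
  then show ?thesis using strict_mono_less[OF strict_mono] by simp
qed

lemma the_block: "m i \<le> n \<Longrightarrow> n < m (Suc i) \<Longrightarrow> (THE i. m i \<le> n \<and> n < m (Suc i)) = i"
  using block_eqI by (intro the_equality) blast+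

lemma l_seq_block: "m i \<le> n \<Longrightarrow> n < m (Suc i) \<Longrightarrow> l_seq m n = i + 2"
  by (simp add: l_seq_def H_seq_def the_block)

text \<open>Block \<open>i\<close> must hold \<open>i + 4\<close> coding positions:
  \<open>i + 3\<close> for a colouring of the values of the next block and one for a bit.\<close>

lemma block_length: "m i + i + 4 \<le> m (Suc i)"
proof -
  have "i + 3 < 2 ^ (i + 3)" by (rule less_exp)
  also have "\<dots> \<le> (4::nat) ^ (i + 3)" by (rule power_mono) simp_all
  finally show ?thesis using gap[of i] by linarith
qed

lemma l_seq_ge: "m i \<le> n \<Longrightarrow> i + 2 \<le> l_seq m n"
proof -
  assume i: "m i \<le> n"
  obtain k where k: "m k \<le> n" "n < m (Suc k)" by (rule obtain_block)
  then have "m i < m (Suc k)" using i by simp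
  then have "i \<le> k" using strict_mono_less[OF strict_mono] by simp
  then show ?thesis using l_seq_block[OF k] by simp
qed

lemma l_seq_at_top: "filterlim (l_seq m) at_top sequentially"
  unfolding filterlim_at_top
proof
  fix i
  show "\<forall>\<^sub>F n in sequentially. i \<le> l_seq m n"
    by (rule eventually_sequentiallyI[of "m i"]) (use l_seq_ge[of i] in fastforce)
qed

text \<open>Eventually the norm is \<open>L / k\<close> with \<open>k \<le> sqrt L\<close>, hence at
  least \<open>sqrt L\<close>, where \<open>L\<close> is the triple logarithm of
  \<open>l_seq m n\<close>. This yields a condition, so the forcing notion is nonempty.\<close>

lemma full_norm_at_top:
  "filterlim (\<lambda>n. f_norm (k_seq m n) (real (l_seq m n)) 0) at_top sequentially"
proof (rule filterlim_at_top_mono)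
  let ?L = "\<lambda>n. log 2 (log 2 (log 2 (real (l_seq m n))))"
  show "filterlim (\<lambda>n. sqrt (?L n)) at_top sequentially"
    by (intro filterlim_compose[OF sqrt_at_top] filterlim_compose[OF filterlim_log2]
        filterlim_compose[OF filterlim_real_sequentially] l_seq_at_top)
  have "\<forall>\<^sub>F n in sequentially. Suc b \<le> l_seq m n" for b
    using l_seq_at_top unfolding filterlim_at_top by blast
  then have "\<forall>\<^sub>F n in sequentially. 2 ^ (2 ^ 16) < l_seq m n"
    unfolding Suc_le_eq .
  then show "\<forall>\<^sub>F n in sequentially. sqrt (?L n) \<le> f_norm (k_seq m n) (real (l_seq m n)) 0"
  proof eventually_elim
    case (elim n)
    define k where "k = real (k_seq m n)"
    note kb = k_seq_bounds[OF elim, folded k_def]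
    have k: "0 < k" using kb(1) unfolding k_def by simp
    have L: "0 \<le> ?L n" using kb(2) by (rule order_trans[rotated]) simp
    have "k \<le> sqrt (?L n)" using kb(2) by (rule real_le_rsqrt)
    then have "k * sqrt (?L n) \<le> sqrt (?L n) * sqrt (?L n)"
      using L by (intro mult_right_mono) auto
    then have "sqrt (?L n) \<le> ?L n / k" using k L by (simp add: field_simps)
    also have "\<dots> = f_norm (k_seq m n) (real (l_seq m n)) 0"
      using f_norm_full[OF elim] unfolding k_def by simp
    finally show ?case .
  qed
qed

lemma forcing_notion_Q_infty:
  "forcing_notion (Q_infty (H_seq m) (K_pair m)) (Q_le (H_seq m) (Sigma_pair m))"
proof -
  \<comment> \<open>With the empty trunk these full creatures form a condition.\<close>
  define t where "t n = simple_creature m n (H_seq m n) 0" for n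
  have adm: "admissible m n (H_seq m n) 0" for n
  proof -
    have "log 2 2 \<le> log 2 (real (l_seq m n))"
      using l_seq_ge_two[of m n] by (subst log_le_cancel_iff) auto
    then have "1 \<le> log 2 (real (l_seq m n))" by simp
    then have "0 \<le> log 2 (log 2 (real (l_seq m n)))" by simp
    then show ?thesis by (auto simp: admissible_def H_seq_def)
  qed
  have "([], t) \<in> Q_infty (H_seq m) (K_pair m)"
  proof (rule Q_inftyI)
    show "t n \<in> K_pair m" for n unfolding t_def using simple_creature_in_K_pair adm by blast
    show "m_dn (t n) = length [] + n" for n
      unfolding t_def using levels_simple_creature(1)[OF admissible_nonempty[OF adm]] by simp
    show "filterlim (\<lambda>n. nor (t n)) at_top sequentially"
      using full_norm_at_top unfolding t_def l_seq_def by simp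
  qed (simp add: seqs_def)
  then show ?thesis
    unfolding forcing_notion_def using Q_le_refl Q_le_trans by blast
qed

end

section \<open>Decoding a generic sequence\<close>

text \<open>
  A generic sequence \<open>W\<close> is decoded from a start \<open>(i, h)\<close>, where \<open>h\<close> colours the \<open>i + 2\<close> values
  of block \<open>i\<close>: the colours of \<open>W (m i), W (m i + 1), \<dots>\<close> spell out a colouring of the \<open>i + 3\<close>
  values of block \<open>i + 1\<close> followed by one bit of the decoded real, and so on from block to block.
  \<open>codes m (i, h) x q\<close> says that all branches of \<open>q\<close> decode to \<open>x\<close>.
\<close>

definition codes ::
  "(nat \<Rightarrow> nat) \<Rightarrow> nat \<times> bool list \<Rightarrow> (nat \<Rightarrow> bool) \<Rightarrow> (nat, nat \<times> nat set \<times> nat) cond \<Rightarrow> bool" where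
  "codes m s x q \<longleftrightarrow> (\<exists>g. g 0 = snd s \<and> (\<forall>d. length (g d) = fst s + d + 2) \<and>
     (\<forall>d. \<forall>j < fst s + d + 4. \<forall>a \<in> allowed q (m (fst s + d) + j). g d ! a = (g (Suc d) @ [x d]) ! j))"

lemma codes_mono:
  assumes "codes m s x q" "q \<in> Q_infty (H_seq m) (K_pair m)" "r \<in> Q_infty (H_seq m) (K_pair m)"
    "Q_le (H_seq m) (Sigma_pair m) q r"
  shows "codes m s x r"
  using assms(1) allowed_antimono[OF assms(2,3,4)] unfolding codes_def by (meson subsetD)

text \<open>Every coordinate has an allowed value, and its colour under \<open>g d\<close> is the
  next coded entry. Thus \<open>g d\<close> determines both \<open>g (Suc d)\<close> and the bit
  \<open>x d\<close>, and the start fixes \<open>g 0\<close>.\<close>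

lemma codes_unique:
  assumes q: "q \<in> Q_infty (H_seq m) (K_pair m)" and xy: "codes m s x q" "codes m s y q"
  shows "x = y"
proof -
  obtain g where g: "g 0 = snd s" "\<And>d. length (g d) = fst s + d + 2"
    "\<And>d j a. j < fst s + d + 4 \<Longrightarrow> a \<in> allowed q (m (fst s + d) + j) \<Longrightarrow> g d ! a = (g (Suc d) @ [x d]) ! j"
    using xy(1) unfolding codes_def by blast
  obtain g' where g': "g' 0 = snd s" "\<And>d. length (g' d) = fst s + d + 2"
    "\<And>d j a. j < fst s + d + 4 \<Longrightarrow> a \<in> allowed q (m (fst s + d) + j) \<Longrightarrow> g' d ! a = (g' (Suc d) @ [y d]) ! j"
    using xy(2) unfolding codes_def by blast
  have step: "g (Suc d) @ [x d] = g' (Suc d) @ [y d]" if d: "g d = g' d" for d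
  proof (rule nth_equalityI)
    fix j assume "j < length (g (Suc d) @ [x d])"
    then have j: "j < fst s + d + 4" by (simp add: g(2))
    obtain a where "a \<in> allowed q (m (fst s + d) + j)" using allowed_nonempty[OF q] by blast
    then show "(g (Suc d) @ [x d]) ! j = (g' (Suc d) @ [y d]) ! j"
      using g(3)[OF j] g'(3)[OF j] d by metis
  qed (simp add: g(2) g'(2))
  have "g d = g' d" for d
    by (induction d) (use g(1) g'(1) step in auto)
  then have "x d = y d" for d using step[of d] by simp
  then show ?thesis by blast
qed

text \<open>Norm 5 makes every \<open>A j\<close> large enough for the group size \<open>g\<close>,
  so one splitting set serves all coding positions of the block; \<open>h\<close> lists its
  characteristic function.\<close>

lemma (in block_sequence) obtain_splitting_colouring:
  assumes i: "2 ^ (2 ^ 16) < i + 2"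
    and A: "\<And>j. j < i + 4 \<Longrightarrow> A j \<subseteq> H_seq m (m i + j)"
    and nor: "\<And>j. j < i + 4 \<Longrightarrow> 5 \<le> f_norm (k_seq m (m i + j)) (real (card (A j))) (real (I j))"
  obtains h :: "bool list" where "length h = i + 2"
    "\<And>j e. j < i + 4 \<Longrightarrow> sqrt (real (card (A j))) \<le> real (card {a \<in> A j. h ! a = e})"
proof -
  obtain g where g: "0 < g" "(i + 2 + 2) * (i + 2) < 2 ^ (g - 1)"
    "real (g + 1) \<le> log 2 (real (i + 2)) ^ 2"
    using i by (rule obtain_group_size)
  have l: "l_seq m (m i + j) = i + 2" if "j < i + 4" for j
    using that block_length[of i] by (intro l_seq_block) auto
  have AN: "A j \<subseteq> {..<i + 2}" if "j < i + 4" for j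
    using A[OF that] H_seq_eq_lessThan[of m "m i + j"] l[OF that] by simp
  have gA: "(g + 1) ^ 2 \<le> card (A j)" if j: "j < i + 4" for j
  proof -
    have "real (g + 1) ^ 2 \<le> (log 2 (real (i + 2)) ^ 2) ^ 2"
      using g(3) by (intro power_mono) simp_all
    also have "\<dots> = log 2 (real (i + 2)) ^ 4" by (simp add: power_mult[symmetric])
    also have "\<dots> \<le> real (card (A j))"
      using log_power4_le[of m "m i + j", OF _ nor[OF j] of_nat_0_le_iff] unfolding l[OF j] using i by blast
    finally show ?thesis by (simp only: of_nat_power[symmetric] of_nat_le_iff)
  qed
  have "i + 2 + 2 = i + 4" by simp
  then have "(i + 4) * (i + 2) < 2 ^ (g - 1)" using g(2) by (simp only:)
  then obtain h where h: "\<And>j. j < i + 4 \<Longrightarrow> sqrt (real (card (A j))) \<le> real (card (A j \<inter> h))"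
    "\<And>j. j < i + 4 \<Longrightarrow> sqrt (real (card (A j))) \<le> real (card (A j - h))"
    using obtain_splitting_set[of "i + 4" A "i + 2" g, OF AN gA _ g(1)] by metis
  define c where "c = map (\<lambda>a. a \<in> h) [0..<i + 2]"
  have c: "c ! a \<longleftrightarrow> a \<in> h" if "a \<in> A j" "j < i + 4" for a j
  proof -
    have "a < i + 2" using AN that by blast
    then show ?thesis unfolding c_def by (simp del: upt_Suc)
  qed
  show thesis
  proof (rule that[of c])
    show "length c = i + 2" by (simp add: c_def)
    fix j and e :: bool assume j: "j < i + 4"
    have "{a \<in> A j. c ! a = e} = (if e then A j \<inter> h else A j - h)"
      using c j by auto
    then show "sqrt (real (card (A j))) \<le> real (card {a \<in> A j. c ! a = e})"
      using h j by simp
  qed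
qed

text \<open>Choose splitting colourings for all late blocks of \<open>p\<close>, then thin each
  coding position to the values of the prescribed colour. Each norm drops by at most 1, so the norms
  still tend to infinity.\<close>

lemma (in block_sequence) codes_dense:
  assumes p: "p \<in> Q_infty (H_seq m) (K_pair m)"
  shows "\<exists>s. \<exists>q \<in> Q_infty (H_seq m) (K_pair m). Q_le (H_seq m) (Sigma_pair m) p q \<and> codes m s x q"
proof -
  obtain w t where wt: "p = (w, t)" by (cases p)
  note D = Q_inftyD[OF p[unfolded wt]]
  obtain n0 where n0: "\<And>n. n0 \<le> n \<Longrightarrow> 5 \<le> nor (t n)"
    using D(4) unfolding filterlim_at_top eventually_sequentially by blast
  have "\<exists>i::nat. b < i + 2 \<and> c \<le> i" for b c
    by (intro exI[of _ "b + c"]) simp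
  \<comment> \<open>As \<open>m i0 \<ge> i0\<close>, block \<open>i0\<close> starts beyond the trunk
    and beyond all creatures of norm below 5.\<close>
  then obtain i0 where i0: "2 ^ (2 ^ 16) < i0 + 2" "length w + n0 \<le> i0" by blast
  have mi0: "length w + n0 \<le> m i0"
    using i0(2) strict_mono_imp_increasing[OF strict_mono, of i0] by linarith
  define A where "A n = pos_set (t (n - length w))" for n
  define I where "I n = snd (snd (dis (t (n - length w))))" for n
  have tA: "admissible m n (A n) (I n)" "t (n - length w) = simple_creature m n (A n) (I n)"
    if n: "length w \<le> n" for n
  proof -
    obtain n' B i where B: "admissible m n' B i" "t (n - length w) = simple_creature m n' B i"
      using D(1) by (rule K_pairE)
    have "n' = n"
      using D(2)[of "n - length w"] n levels_simple_creature(1)[OF admissible_nonempty[OF B(1)]] B(2)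
      by simp
    then show "admissible m n (A n) (I n)" "t (n - length w) = simple_creature m n (A n) (I n)"
      using B unfolding A_def I_def by simp_all
  qed
  have Anor: "5 \<le> f_norm (k_seq m n) (real (card (A n))) (real (I n))" if n: "m i0 \<le> n" for n
  proof -
    have "5 \<le> nor (t (n - length w))" using n mi0 by (intro n0) simp
    then show ?thesis using tA(2)[of n] n mi0 by simp
  qed
  have AH: "A n \<subseteq> H_seq m n" "A n \<noteq> {}" "finite (A n)" if "length w \<le> n" for n
    using tA(1)[OF that] finite_H_seq finite_subset unfolding admissible_def by blast+
  have mono_m: "m i0 \<le> m i" if "i0 \<le> i" for i
    using strict_mono_less_eq[OF strict_mono] that by blast
  \<comment> \<open>There is no circularity in coding the next colouring: each colouring depends
    only on the sets of \<open>p\<close> and leaves either colour available at every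
    position.\<close>
  have "\<exists>h :: bool list. i0 \<le> i \<longrightarrow> length h = i + 2 \<and> (\<forall>j e. j < i + 4 \<longrightarrow>
      sqrt (real (card (A (m i + j)))) \<le> real (card {a \<in> A (m i + j). h ! a = e}))" for i
  proof (cases "i0 \<le> i")
    case True
    have "2 ^ (2 ^ 16) < i + 2" using i0(1) by (rule less_le_trans) (use True in simp)
    then obtain h :: "bool list" where "length h = i + 2"
      "\<And>j e. j < i + 4 \<Longrightarrow> sqrt (real (card (A (m i + j)))) \<le> real (card {a \<in> A (m i + j). h ! a = e})"
      by (rule obtain_splitting_colouring[of i "\<lambda>j. A (m i + j)" "\<lambda>j. I (m i + j)"])
        (use AH Anor mono_m[OF True] mi0 in auto)
    then show ?thesis by blast
  qed simp
  then obtain h :: "nat \<Rightarrow> bool list" where h: "\<And>i. i0 \<le> i \<Longrightarrow> length (h i) = i + 2"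
    "\<And>i j e. i0 \<le> i \<Longrightarrow> j < i + 4 \<Longrightarrow>
      sqrt (real (card (A (m i + j)))) \<le> real (card {a \<in> A (m i + j). h i ! a = e})"
    by metis
  define blk where "blk n = (THE i. m i \<le> n \<and> n < m (Suc i))" for n
  \<comment> \<open>Positions of a block after the coding ones keep their sets; bits are counted
    from block \<open>i0\<close>.\<close>
  define B where "B n = (if n < m (blk n) + blk n + 4
    then {a \<in> A n. h (blk n) ! a = (h (Suc (blk n)) @ [x (blk n - i0)]) ! (n - m (blk n))} else A n)" for n
  have BA: "B n \<subseteq> A n" for n unfolding B_def by auto
  have Bcard: "sqrt (real (card (A n))) \<le> real (card (B n))" if n: "m i0 \<le> n" for n
  proof (cases "n < m (blk n) + blk n + 4")
    case True
    obtain k where k: "m k \<le> n" "n < m (Suc k)" by (rule obtain_block)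
    have b: "blk n = k" unfolding blk_def using k by (rule the_block)
    have "m i0 < m (Suc k)" using n k by simp
    then have "i0 \<le> k" using strict_mono_less[OF strict_mono] by simp
    then have "sqrt (real (card (A (m k + (n - m k))))) \<le> real (card {a \<in> A (m k + (n - m k)).
      h k ! a = (h (Suc k) @ [x (k - i0)]) ! (n - m k)})"
      by (rule h(2)) (use True k b in auto)
    then show ?thesis using True k unfolding B_def b by simp
  next
    case False
    have "1 \<le> card (A n)" using AH[of n] n mi0 by (simp add: Suc_le_eq card_gt_0_iff)
    then have "sqrt (real (card (A n))) * 1 \<le> sqrt (real (card (A n))) * sqrt (real (card (A n)))"
      by (intro mult_left_mono) auto
    then show ?thesis using False unfolding B_def by simp
  qed
  have Badm: "admissible m n (B n) (I n)" if n: "m i0 \<le> n" for n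
  proof (rule admissible_mono[OF tA(1) BA])
    have "0 < sqrt (real (card (A n)))" using AH[of n] n mi0 by (simp add: card_gt_0_iff)
    then show "B n \<noteq> {}" using Bcard[OF n] by auto
  qed (use n mi0 in simp)
  \<comment> \<open>Coordinates before block \<open>i0\<close> code nothing, so the trunk is
    prolonged by arbitrary possible values.\<close>
  define w' where "w' = map (\<lambda>n. if n < length w then w ! n else SOME a. a \<in> A n) [0..<m i0]"
  define t' where "t' n = simple_creature m (m i0 + n) (B (m i0 + n)) (I (m i0 + n))" for n
  have lw': "length w' = m i0" by (simp add: w'_def)
  have some_A: "(SOME a. a \<in> A n) \<in> A n" if "length w \<le> n" for n
    using AH(2)[OF that] by (simp add: some_in_eq)
  have q: "(w', t') \<in> Q_infty (H_seq m) (K_pair m)"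
  proof (rule Q_inftyI)
    show "t' n \<in> K_pair m" for n unfolding t'_def by (intro simple_creature_in_K_pair Badm) simp
    show "m_dn (t' n) = length w' + n" for n
      unfolding t'_def lw' by (intro levels_simple_creature(1) admissible_nonempty[OF Badm]) simp
    have "w' ! k \<in> H_seq m k" if k: "k < m i0" for k
    proof (cases "k < length w")
      case True
      then show ?thesis using k D(3) by (simp add: w'_def seqs_def)
    next
      case False
      then have "(SOME a. a \<in> A k) \<in> H_seq m k" using some_A[of k] AH(1)[of k] by auto
      then show ?thesis using k False by (simp add: w'_def)
    qed
    then show "w' \<in> seqs (H_seq m) (length w')" by (simp add: seqs_def lw')
    have "- 1 + nor (t (n + (m i0 - length w))) \<le> nor (t' n)" for n
    proof -
      have "nor (t (m i0 + n - length w)) - 1 \<le> nor (t' n)"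
        using tA(2)[of "m i0 + n"] mi0 f_norm_sqrt[OF Anor _ Bcard, of "m i0 + n"]
        unfolding t'_def by simp
      moreover have "m i0 + n - length w = n + (m i0 - length w)" using mi0 by simp
      ultimately show ?thesis by simp
    qed
    then have "\<forall>\<^sub>F n in sequentially. - 1 + nor (t (n + (m i0 - length w))) \<le> nor (t' n)"
      by (simp only: eventually_True)
    with filterlim_tendsto_add_at_top[OF tendsto_const
        filterlim_compose[OF D(4) filterlim_add_const_nat_at_top]]
    show "filterlim (\<lambda>n. nor (t' n)) at_top sequentially"
      by (rule filterlim_at_top_mono)
  qed
  have le: "Q_le (H_seq m) (Sigma_pair m) p (w', t')"
    unfolding wt Q_le_iff[OF p[unfolded wt] q] fst_conv snd_conv
  proof (intro exI[of _ "m i0 - length w"] conjI allI impI)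
    show "length w' = length w + (m i0 - length w)" using lw' mi0 by simp
    have "take (length w) w' = w" using mi0 by (intro nth_equalityI) (auto simp: w'_def)
    then show "prefix w w'" by (metis take_is_prefix)
    fix n
    show "w' ! (length w + n) \<in> pos_set (t n)" if "n < m i0 - length w"
      using that some_A[of "length w + n"] unfolding w'_def by (simp add: A_def)
    have "t (n + (m i0 - length w)) = t (m i0 + n - length w)" using mi0 by (simp add: add.commute)
    also have "\<dots> = simple_creature m (m i0 + n) (A (m i0 + n)) (I (m i0 + n))"
      using tA(2) mi0 by simp
    finally show "t' n \<in> Sigma_pair m (t (n + (m i0 - length w)))"
      using Badm[of "m i0 + n"] BA unfolding t'_def by (auto simp: Sigma_pair_simple_creature)
  qed
  have "codes m (i0, h i0) x (w', t')"
    unfolding codes_def fst_conv snd_conv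
  proof (intro exI[of _ "\<lambda>d. h (i0 + d)"] conjI allI impI ballI)
    fix d j a assume j: "j < i0 + d + 4" and a: "a \<in> allowed (w', t') (m (i0 + d) + j)"
    have "m i0 \<le> m (i0 + d)" by (rule mono_m) simp
    then have "a \<in> B (m (i0 + d) + j)" using a lw' by (simp add: allowed_def t'_def)
    moreover have "blk (m (i0 + d) + j) = i0 + d"
      unfolding blk_def using block_length[of "i0 + d"] j by (intro the_block) auto
    ultimately show "h (i0 + d) ! a = (h (i0 + Suc d) @ [x d]) ! j"
      using j by (simp add: B_def)
  qed (use h(1) in simp_all)
  then show ?thesis using q le by blast
qed

theorem lemma4p4:
  fixes m :: "nat \<Rightarrow> nat"
  assumes "strict_mono m" and "m 0 = 0"
    and "\<forall>i. m (i + 1) - m i > 4 ^ (i + 3)"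
  shows "good_creating_pair (H_seq m) (K_pair m) (Sigma_pair m) \<and>
    local_creatures (K_pair m) \<and>
    forgetful (H_seq m) (K_pair m) \<and>
    strongly_finitary (H_seq m) (K_pair m) \<and>
    forcing_notion (Q_infty (H_seq m) (K_pair m)) (Q_le (H_seq m) (Sigma_pair m)) \<and>
    collapses_continuum (Q_infty (H_seq m) (K_pair m)) (Q_le (H_seq m) (Sigma_pair m))"
proof -
  interpret block_sequence m
    using assms by unfold_locales simp_all
  have "collapses_continuum (Q_infty (H_seq m) (K_pair m)) (Q_le (H_seq m) (Sigma_pair m))"
    unfolding collapses_continuum_def
  \<comment> \<open>A start is a number with a list of bits, so \<open>from_nat\<close> enumerates
    all starts; the \<open>n\<close>-th term of the sequence is the real decoded from the
    \<open>n\<close>-th start.\<close>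
  proof (intro ballI f_countable_if_dense_decisions[OF forcing_notion_Q_infty,
        where D = "\<lambda>n. codes m (from_nat n)"])
    show "\<exists>n. \<exists>r\<in>Q_infty (H_seq m) (K_pair m).
        Q_le (H_seq m) (Sigma_pair m) q r \<and> codes m (from_nat n) x r"
      if "q \<in> Q_infty (H_seq m) (K_pair m)" for x q
      using codes_dense[OF that, of x] from_nat_to_nat by metis
  qed (use codes_mono codes_unique in blast)+
  then show ?thesis
    using good_creating_pair_K_pair local_creatures_K_pair forgetful_K_pair
      strongly_finitary_K_pair forcing_notion_Q_infty by blast
qed

end
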